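(* Let $\nu>2$ and let $m=m(n)$ be polynomially bounded in $n$ with $m\in\Omega(n^{\nu})$. Let $U\in U(m)$ be drawn from the Haar measure $\mu_H$. Then, with probability supra-exponentially close to one in $n$, no symmetric probabilistic algorithm can distinguish the post-selected Boson-Sampling distribution $\mathcal{D}^*_U$ from the uniform distribution on $\Phi^*_{m,n}$ from fewer than $\Omega(\mathrm{e}^{n/2})$ many samples. Explicitly: there exist a constant $a>0$ and a function $\delta:\mathbb{Z}^+\to[0,1]$ with $\lim_{n\to\infty}\delta(n)\,\mathrm{e}^{Cn}=0$ for every $C>0$ such that for all $n$ the following holds with probability at least $1-\delta(n)$ over $U\sim\mu_H$: for every $l\le a\,\mathrm{e}^{n/2}$, no symmetric probabilistic algorithm receiving $l$ samples distinguishes $\mathcal{D}^*_U$ from the uniform distribution on $\Phi^*_{m,n}$.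
   Context: Boson-Sampling. Let $n\ge1$ (number of bosons) and $m\ge n$ (number of modes); throughout $m\in\mathrm{poly}(n)$. The sample space is $\Phi_{m,n}=\{(s_1,\dots,s_m)\in\mathbb{Z}_{\ge0}^m:\sum_{j=1}^m s_j=n\}$, and the collision-free sample space is $\Phi^*_{m,n}=\{S\in\Phi_{m,n}: s_j\in\{0,1\}\ \forall j\}$. For $U\in U(m)$ and $S=(s_1,\dots,s_m)\in\Phi_{m,n}$, $U_S\in\mathbb{C}^{n\times n}$ is the matrix obtained from $U$ by keeping only the first $n$ columns and then taking, for each $j=1,\dots,m$, $s_j$ copies of the $j$-th row. The permanent of an $n\times n$ matrix $X$ is $\operatorname{Perm}(X)=\sum_{\tau\in\mathrm{Sym}(\{1,\dots,n\})}\prod_{j=1}^n x_{j,\tau(j)}$. The Boson-Sampling distribution $\mathcal{D}_U$ on $\Phi_{m,n}$ is $\Pr_{\mathcal{D}_U}[S]=|\operatorname{Perm}(U_S)|^2/\prod_{j=1}^m s_j!$. The post-selected Boson-Sampling distribution $\mathcal{D}^*_U$ is $\mathcal{D}_U$ conditioned on the outcome lying in $\Phi^*_{m,n}$. Symmetric probabilistic algorithm (one black box). For a finite sample space $\Phi$ and $l\in\mathbb{Z}^+$, a probabilistic decision algorithm takes as input a sequence $(S_1,\dots,S_l)\in\Phi^l$ and outputs at random either "accept" or "reject". It is symmetric if its output distribution is invariant under permuting the samples, $(S_1,\dots,S_l)\mapsto(S_{\tau(1)},\dots,S_{\tau(l)})$ with $\tau\in\mathrm{Sym}(\{1,\dots,l\})$,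 and under relabeling the sample space, $(S_1,\dots,S_l)\mapsto(\kappa(S_1),\dots,\kappa(S_l))$ with $\kappa\in\mathrm{Sym}(\Phi)$. Distinguishing. An algorithm receiving $l$ samples distinguishes $\mathcal{P}$ from $\mathcal{Q}$ (both on $\Phi$) if it accepts with probability at least $2/3$ when its input consists of $l$ independent samples from $\mathcal{P}$ and rejects with probability at least $2/3$ when its input consists of $l$ independent samples from $\mathcal{Q}$. *)

theory Defs
  imports
    "HOL-Probability.Probability"
    "HOL-Combinatorics.Permutations"
    "HOL-Library.Landau_Symbols"
    "Jordan_Normal_Form.Schur_Decomposition"
begin

section \<open>Haar measure on the unitary group\<close>

definition unitary_group :: "nat \<Rightarrow> complex mat set" where
  "unitary_group m = {U \<in> carrier_mat m m. mat_adjoint U * U = 1\<^sub>m m}"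

text \<open>
  The Borel sigma-algebra of the unitary group, as a subspace of the space of all complex
  matrices of size \<open>m\<close>, is generated by the matrix entries.
\<close>

definition unitary_borel :: "nat \<Rightarrow> complex mat measure" where
  "unitary_borel m = vimage_algebra (unitary_group m)
     (\<lambda>U. \<lambda>(i, j) \<in> {..<m} \<times> {..<m}. U $$ (i, j))
     (\<Pi>\<^sub>M ij \<in> {..<m} \<times> {..<m}. (borel :: complex measure))"

text \<open>
  On the compact group \<open>U(m)\<close> there is exactly one left-invariant Borel probability measure,
  namely Haar measure.
\<close>

definition is_haar_measure :: "nat \<Rightarrow> complex mat measure \<Rightarrow> bool" where
  "is_haar_measure m \<mu> \<longleftrightarrow>
     prob_space \<mu> \<and> space \<mu> = unitary_group m \<and> sets \<mu> = sets (unitary_borel m) \<and>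
     (\<forall>V \<in> unitary_group m. distr \<mu> \<mu> (\<lambda>U. V * U) = \<mu>)"


section \<open>Boson-Sampling\<close>

text \<open>Outcomes \<open>(s\<^sub>1, \<dots>, s\<^sub>m)\<close> are lists of length \<open>m\<close>; rows and columns are numbered from 0.\<close>

definition sample_space :: "nat \<Rightarrow> nat \<Rightarrow> nat list set" where
  "sample_space m n = {S. length S = m \<and> sum_list S = n}"

definition collision_free :: "nat \<Rightarrow> nat \<Rightarrow> nat list set" where
  "collision_free m n = {S \<in> sample_space m n. set S \<subseteq> {0, 1}}"

text \<open>The row indices of \<open>U\<^sub>S\<close>: each \<open>j\<close> is repeated \<open>s\<^sub>j\<close> times.\<close>

definition row_indices :: "nat list \<Rightarrow> nat list" where
  "row_indices S = concat (map (\<lambda>j. replicate (S ! j) j) [0..<length S])"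

definition boson_submatrix :: "nat \<Rightarrow> complex mat \<Rightarrow> nat list \<Rightarrow> complex mat" where
  "boson_submatrix n U S = Matrix.mat n n (\<lambda>(i, j). U $$ (row_indices S ! i, j))"

definition permanent :: "'a :: comm_ring_1 mat \<Rightarrow> 'a" where
  "permanent X =
     (\<Sum>\<tau> | \<tau> permutes {0..<dim_row X}. \<Prod>j = 0..<dim_row X. X $$ (j, \<tau> j))"

text \<open>
  For unitary \<open>U\<close> of size \<open>m \<ge> n\<close> the weights below are nonnegative and sum to 1, so they are
  the probabilities of the distribution. Other matrices \<open>U\<close> do not matter.
\<close>

definition boson_sampling :: "nat \<Rightarrow> nat \<Rightarrow> complex mat \<Rightarrow> nat list pmf" where
  "boson_sampling m n U = embed_pmf (\<lambda>S.
     if S \<in> sample_space m n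
     then (cmod (permanent (boson_submatrix n U S)))\<^sup>2 / (\<Prod>j<m. fact (S ! j))
     else 0)"

text \<open>
  \<^const>\<open>cond_pmf\<close> is unspecified if the event conditioned on has probability zero, so nothing
  can be derived about post-selection for such \<open>U\<close>.
\<close>

definition postselected_boson_sampling :: "nat \<Rightarrow> nat \<Rightarrow> complex mat \<Rightarrow> nat list pmf" where
  "postselected_boson_sampling m n U = cond_pmf (boson_sampling m n U) (collision_free m n)"


section \<open>Symmetric probabilistic algorithms\<close>

text \<open>
  An algorithm maps a sequence of samples to the distribution of its output, where \<open>True\<close> means
  accept and \<open>False\<close> means reject. Only its values on sequences of length \<open>l\<close> over \<open>\<Phi>\<close> matter.
\<close>

definition symmetric_algorithm ::
  "'a set \<Rightarrow> nat \<Rightarrow> ('a list \<Rightarrow> bool pmf) \<Rightarrow> bool" where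
  "symmetric_algorithm \<Phi> l A \<longleftrightarrow>
     (\<forall>xs. length xs = l \<and> set xs \<subseteq> \<Phi> \<longrightarrow>
        (\<forall>\<tau>. \<tau> permutes {..<l} \<longrightarrow> A (permute_list \<tau> xs) = A xs) \<and>
        (\<forall>\<kappa>. \<kappa> permutes \<Phi> \<longrightarrow> A (map \<kappa> xs) = A xs))"

definition distinguishes ::
  "nat \<Rightarrow> ('a list \<Rightarrow> bool pmf) \<Rightarrow> 'a pmf \<Rightarrow> 'a pmf \<Rightarrow> bool" where
  "distinguishes l A P Q \<longleftrightarrow>
     pmf (bind_pmf (replicate_pmf l P) A) True \<ge> 2 / 3 \<and>
     pmf (bind_pmf (replicate_pmf l Q) A) False \<ge> 2 / 3"

end

(* Let E be the set of unitaries all of whose rows satisfy r_i = sum over j < n of |U_ij|^2 <= 1/(4n).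
   For U in E every collision-free outcome has weight at most prod (n r_i) <= 4^-n (bound the permanent
   by the product of the l1-norms of the rows), and the outcomes with a collision have total weight at
   most 2 * sum r_i^2 <= 1/2.  Hence every probability of the post-selected distribution, and then also
   1/|Phi*|, is at most 2 e^-n.  By a birthday bound l <= e^(n/2)/4 samples are then pairwise distinct
   with probability close to 1, and on pairwise distinct samples a symmetric algorithm ignores its input.

   E fails with probability at most 2 m exp(3n - m/(32n)), which is supra-exponentially small because
   m >= c n^nu with nu > 2: the real and imaginary parts of the first n entries of a row form a
   subgaussian vector of variance 1/m under Haar measure, so a Gaussian mixture of their exponential
   moments bounds the exponential moment of r_i. *)

theory Submission
  imports Defs "HOL-Combinatorics.Multiset_Permutations" "HOL-Real_Asymp.Real_Asymp"
begin

section \<open>Symmetric algorithms on distinct samples\<close>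

text \<open>Controlling the permanents directly would mean a union bound over (m choose n) dependent
  random quantities. E concerns only the m rows, and on E all outcomes are controlled at once by
  deterministic estimates. The row masses add up to n, so their mean is n/m, far below 1/(4n) as
  soon as m outgrows n^2. The tail exponent m/(32n) must beat C n for every C, and this is where
  \<nu> > 2 enters. The obstacle is that Haar measure is given only by left invariance, with no
  density or coordinates. Exponential moments are therefore obtained by averaging over left
  translates by unitaries with flat entries and independent signs, so that for each fixed U only a
  finite sum over signs has to be bounded.\<close>

lemma measure_bind_pmf:
  "measure_pmf.prob (bind_pmf p f) S = (\<integral>x. measure_pmf.prob (f x) S \<partial>p)"
proof -
  have prob: "measure_pmf.prob q S = pmf (map_pmf (\<lambda>y. y \<in> S) q) True" for q
    by (simp add: pmf_map vimage_def)
  show ?thesis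
    unfolding prob map_bind_pmf by (rule pmf_bind)
qed

text \<open>Given \<open>l\<close> earlier samples, the next one hits one of their at most
  \<open>l\<close> values with probability at most \<open>l * M\<close>. The induction carries the
  sharper \<open>l * (l - 1) / 2\<close> and relaxes it at the end.\<close>

lemma measure_replicate_pmf_not_distinct_le:
  fixes P :: "'a pmf"
  assumes M: "\<And>x. pmf P x \<le> M"
  shows "measure_pmf.prob (replicate_pmf l P) {xs. \<not> distinct xs} \<le> M * real l ^ 2 / 2"
proof -
  have M0: "0 \<le> M" using M[of undefined] pmf_nonneg[of P undefined] by linarith
  have "measure_pmf.prob (replicate_pmf l P) {xs. \<not> distinct xs} \<le> M * (real l * (real l - 1) / 2)"
  proof (induction l)
    case 0
    then show ?case by simp
  next
    case (Suc l)
    let ?R = "replicate_pmf l P"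
    have len: "length xs = l" if "xs \<in> set_pmf ?R" for xs
      using that by (simp add: set_replicate_pmf)
    have inner: "measure_pmf.prob P (set xs) \<le> real l * M" if "xs \<in> set_pmf ?R" for xs
    proof -
      have "measure_pmf.prob P (set xs) = (\<Sum>x\<in>set xs. pmf P x)"
        by (simp add: measure_measure_pmf_finite)
      also have "\<dots> \<le> real (card (set xs)) * M"
        using sum_bounded_above[of "set xs" "pmf P" M] M by simp
      also have "\<dots> \<le> real l * M"
        using card_length[of xs] len[OF that] M0 by (intro mult_right_mono) auto
      finally show ?thesis .
    qed
    \<comment> \<open>\<open>replicate_pmf\<close> draws the head before the tail. Commuting the
      draws makes the new sample independent of a tail that is already fixed.\<close>
    have eq: "replicate_pmf (Suc l) P = bind_pmf ?R (\<lambda>xs. map_pmf (\<lambda>x. x # xs) P)"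
      by (simp add: map_pmf_def) (rule bind_commute_pmf)
    have "measure_pmf.prob (replicate_pmf (Suc l) P) {xs. \<not> distinct xs}
        = (\<integral>xs. measure_pmf.prob (map_pmf (\<lambda>x. x # xs) P) {xs. \<not> distinct xs} \<partial>?R)"
      unfolding eq by (rule measure_bind_pmf)
    also have "\<dots> = (\<integral>xs. measure_pmf.prob P {x. x \<in> set xs \<or> \<not> distinct xs} \<partial>?R)"
      by (simp add: vimage_def)
    also have "\<dots> \<le> (\<integral>xs. real l * M + indicator {xs. \<not> distinct xs} xs \<partial>?R)"
    proof (intro integral_mono_AE)
      show "AE xs in ?R. measure_pmf.prob P {x. x \<in> set xs \<or> \<not> distinct xs}
          \<le> real l * M + indicator {xs. \<not> distinct xs} xs"
        using inner M0 by (auto simp: AE_measure_pmf_iff indicator_def Collect_mem_eq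
            intro!: order.trans[OF measure_pmf.prob_le_1])
    qed (auto intro!: measure_pmf.integrable_const_bound[where B=1] Bochner_Integration.integrable_add)
    also have "\<dots> = real l * M + measure_pmf.prob ?R {xs. \<not> distinct xs}"
      by (subst Bochner_Integration.integral_add) 
        (auto intro!: measure_pmf.integrable_const_bound[where B=1])
    also have "\<dots> \<le> real l * M + M * (real l * (real l - 1) / 2)"
      using Suc.IH by simp
    also have "\<dots> = M * (real (Suc l) * (real (Suc l) - 1) / 2)"
      by (simp add: field_simps)
    finally show ?case .
  qed
  also have "\<dots> \<le> M * (real l ^ 2 / 2)"
    using M0 by (intro mult_left_mono) (auto simp: power2_eq_square field_simps)
  finally show ?thesis by simp
qed

text \<open>Sending \<open>xs ! i\<close> to \<open>ys ! i\<close> is a bijection between subsets of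
  equal size, and in a finite \<open>\<Phi>\<close> their complements are equinumerous, so it
  extends. Thus relabeling moves any distinct sample sequence onto any other of the same
  length.\<close>

lemma distinct_lists_permutes:
  assumes "finite \<Phi>" "distinct xs" "distinct ys" "length xs = length ys" "set xs \<subseteq> \<Phi>" "set ys \<subseteq> \<Phi>"
  shows "\<exists>\<kappa>. \<kappa> permutes \<Phi> \<and> map \<kappa> xs = ys"
proof -
  have c: "card (set xs) = card (set ys)"
    using assms by (simp add: distinct_card)
  have "card (\<Phi> - set xs) = card (\<Phi> - set ys)"
    using assms c by (simp add: card_Diff_subset)
  then obtain g where g: "bij_betw g (\<Phi> - set xs) (\<Phi> - set ys)"
    using assms(1) by (meson finite_Diff finite_same_card_bij)
  define f where "f x = the (map_of (zip xs ys) x)" for x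
  have f_nth: "f (xs ! i) = ys ! i" if "i < length xs" for i
    using that assms by (simp add: f_def map_of_zip_nth)
  have mf: "map f xs = ys"
    using f_nth assms by (auto intro: nth_equalityI)
  have bf: "bij_betw f (set xs) (set ys)"
    using mf assms distinct_map[of f xs] by (metis bij_betw_def list.set_map)
  define \<kappa> where "\<kappa> x = (if x \<in> set xs then f x else if x \<in> \<Phi> then g x else x)" for x
  have "bij_betw \<kappa> (set xs \<union> (\<Phi> - set xs)) (set ys \<union> (\<Phi> - set ys))"
  proof (rule bij_betw_combine)
    show "bij_betw \<kappa> (set xs) (set ys)"
      using bf by (subst bij_betw_cong[of _ _ f]) (auto simp: \<kappa>_def)
    show "bij_betw \<kappa> (\<Phi> - set xs) (\<Phi> - set ys)"
      using g by (subst bij_betw_cong[of _ _ g]) (auto simp: \<kappa>_def)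
  qed auto
  moreover have "set xs \<union> (\<Phi> - set xs) = \<Phi>" "set ys \<union> (\<Phi> - set ys) = \<Phi>"
    using assms by auto
  ultimately have "\<kappa> permutes \<Phi>"
    by (intro bij_imp_permutes) (use assms in \<open>auto simp: \<kappa>_def\<close>)
  moreover have "map \<kappa> xs = ys"
    using mf by (auto simp: \<kappa>_def)
  ultimately show ?thesis by blast
qed

text \<open>On distinct sequences \<open>A\<close> has one fixed output distribution
  \<open>b\<close>. Acceptance under \<open>P\<close> and rejection under \<open>Q\<close> exceed
  \<open>pmf b True\<close> and \<open>pmf b False\<close> by at most
  \<open>M * l\<^sup>2 / 2\<close> each, so they add up to at most
  \<open>1 + M * l\<^sup>2 < 4 / 3\<close>, whereas distinguishing requires
  \<open>2 / 3 + 2 / 3\<close>.\<close>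

lemma symmetric_algorithm_not_distinguishes:
  assumes fin: "finite \<Phi>" and sym: "symmetric_algorithm \<Phi> l A"
    and P: "set_pmf P \<subseteq> \<Phi>" "\<And>x. pmf P x \<le> M"
    and Q: "set_pmf Q \<subseteq> \<Phi>" "\<And>x. pmf Q x \<le> M"
    and small: "M * real l ^ 2 < 1 / 3"
  shows "\<not> distinguishes l A P Q"
proof
  assume dist: "distinguishes l A P Q"
  let ?D = "{xs. length xs = l \<and> set xs \<subseteq> \<Phi> \<and> distinct xs}"
  \<comment> \<open>If no distinct sequence of length \<open>l\<close> exists, \<open>b\<close> is
    arbitrary; the estimate below remains true because then every sequence counts as
    non-distinct.\<close>
  define b where "b = A (SOME xs. xs \<in> ?D)"
  have A_eq: "A xs = b" if xs: "xs \<in> ?D" for xs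
  proof -
    define ys where "ys = (SOME xs. xs \<in> ?D)"
    have "ys \<in> ?D"
      unfolding ys_def using xs by (rule someI)
    then obtain \<kappa> where "\<kappa> permutes \<Phi>" "map \<kappa> xs = ys"
      using distinct_lists_permutes[of \<Phi> xs ys] xs fin by auto
    thus ?thesis
      using sym xs unfolding symmetric_algorithm_def b_def ys_def[symmetric] by auto
  qed
  have bound: "pmf (bind_pmf (replicate_pmf l R) A) c \<le> M * real l ^ 2 / 2 + pmf b c"
    if R: "set_pmf R \<subseteq> \<Phi>" "\<And>x. pmf R x \<le> M" for R c
  proof -
    have "pmf (bind_pmf (replicate_pmf l R) A) c = (\<integral>xs. pmf (A xs) c \<partial>replicate_pmf l R)"
      by (rule pmf_bind)
    also have "\<dots> \<le> (\<integral>xs. indicator {xs. \<not> distinct xs} xs + pmf b c \<partial>replicate_pmf l R)"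
    proof (intro integral_mono_AE)
      have "pmf (A xs) c \<le> indicator {xs. \<not> distinct xs} xs + pmf b c"
        if "xs \<in> set_pmf (replicate_pmf l R)" for xs
      proof (cases "distinct xs")
        case True
        with that R have "xs \<in> ?D" by (auto simp: set_replicate_pmf)
        thus ?thesis using A_eq by simp
      qed (use pmf_le_1[of "A xs" c] pmf_nonneg[of b c] in \<open>simp add: add_increasing2\<close>)
      thus "AE xs in replicate_pmf l R. pmf (A xs) c \<le> indicator {xs. \<not> distinct xs} xs + pmf b c"
        by (auto simp: AE_measure_pmf_iff)
    qed (auto intro!: measure_pmf.integrable_const_bound[where B=1] Bochner_Integration.integrable_add
          simp: pmf_le_1)
    also have "\<dots> = measure_pmf.prob (replicate_pmf l R) {xs. \<not> distinct xs} + pmf b c"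
      by (subst Bochner_Integration.integral_add)
        (auto intro!: measure_pmf.integrable_const_bound[where B=1])
    also have "\<dots> \<le> M * real l ^ 2 / 2 + pmf b c"
      using measure_replicate_pmf_not_distinct_le[of R M l] R by simp
    finally show ?thesis .
  qed
  have "pmf b True + pmf b False = 1"
  proof -
    have "(\<Sum>c\<in>{True, False}. pmf b c) = 1"
      by (rule sum_pmf_eq_1) auto
    thus ?thesis by simp
  qed
  with bound[OF P, of True] bound[OF Q, of False] dist small show False
    unfolding distinguishes_def by simp
qed

section \<open>Rows of Haar-distributed unitary matrices\<close>

lemma mat_adjoint_carrier: "A \<in> carrier_mat n n \<Longrightarrow> mat_adjoint A \<in> carrier_mat n n"
  by (auto simp: mat_adjoint_def)

lemma mat_adjoint_index:
  fixes A :: "complex mat"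
  assumes "A \<in> carrier_mat n n" "i < n" "j < n"
  shows "mat_adjoint A $$ (i, j) = cnj (A $$ (j, i))"
  using assms by (simp add: mat_adjoint_def mat_of_rows_index)

lemma mat_adjoint_mult:
  fixes A B :: "complex mat"
  assumes "A \<in> carrier_mat n n" "B \<in> carrier_mat n n"
  shows "mat_adjoint (A * B) = mat_adjoint B * mat_adjoint A"
proof (rule eq_matI)
  note carr = assms mult_carrier_mat[OF assms] mat_adjoint_carrier[OF assms(1)]
    mat_adjoint_carrier[OF assms(2)] mat_adjoint_carrier[OF mult_carrier_mat[OF assms]]
  show "dim_row (mat_adjoint (A * B)) = dim_row (mat_adjoint B * mat_adjoint A)"
    "dim_col (mat_adjoint (A * B)) = dim_col (mat_adjoint B * mat_adjoint A)"
    using carr by auto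
  fix i j assume "i < dim_row (mat_adjoint B * mat_adjoint A)" "j < dim_col (mat_adjoint B * mat_adjoint A)"
  hence ij: "i < n" "j < n" using carr by auto
  have "mat_adjoint (A * B) $$ (i, j) = (\<Sum>k<n. cnj (A $$ (j, k)) * cnj (B $$ (k, i)))"
    using ij carr by (subst mat_adjoint_index[of _ n]) (auto simp: scalar_prod_def atLeast0LessThan)
  also have "\<dots> = (mat_adjoint B * mat_adjoint A) $$ (i, j)"
    using ij carr by (auto simp: scalar_prod_def atLeast0LessThan mat_adjoint_index[of _ n] mult.commute
        intro!: sum.cong)
  finally show "mat_adjoint (A * B) $$ (i, j) = (mat_adjoint B * mat_adjoint A) $$ (i, j)" .
qed

lemma unitary_group_mult:
  assumes "V \<in> unitary_group m" "U \<in> unitary_group m"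
  shows "V * U \<in> unitary_group m"
proof -
  have c: "V \<in> carrier_mat m m" "U \<in> carrier_mat m m"
    using assms by (auto simp: unitary_group_def)
  have "mat_adjoint (V * U) * (V * U) = mat_adjoint U * (mat_adjoint V * V * U)"
    using c mat_adjoint_carrier[OF c(1)] mat_adjoint_carrier[OF c(2)]
    by (subst mat_adjoint_mult[OF c]) (simp add: assoc_mult_mat[of _ m m _ m _ m])
  also have "\<dots> = 1\<^sub>m m"
    using assms c by (simp add: unitary_group_def)
  finally show ?thesis
    using c by (simp add: unitary_group_def)
qed

text \<open>Orthonormality of the columns is the form in which unitarity enters all later sums over
  rows.\<close>

lemma unitary_group_iff:
  "U \<in> unitary_group m \<longleftrightarrow> U \<in> carrier_mat m m \<and>
     (\<forall>i<m. \<forall>j<m. (\<Sum>l<m. cnj (U $$ (l, i)) * U $$ (l, j)) = (if i = j then 1 else 0))"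
proof -
  have *: "(mat_adjoint U * U) $$ (i, j) = (\<Sum>l<m. cnj (U $$ (l, i)) * U $$ (l, j))"
    if "U \<in> carrier_mat m m" "i < m" "j < m" for i j
    using that mat_adjoint_carrier[OF that(1)]
    by (auto simp: scalar_prod_def atLeast0LessThan mat_adjoint_index[of _ m] intro!: sum.cong)
  have "mat_adjoint U * U = 1\<^sub>m m \<longleftrightarrow>
     (\<forall>i<m. \<forall>j<m. (\<Sum>l<m. cnj (U $$ (l, i)) * U $$ (l, j)) = (if i = j then 1 else 0))"
    if "U \<in> carrier_mat m m"
  proof
    assume "mat_adjoint U * U = 1\<^sub>m m"
    thus "\<forall>i<m. \<forall>j<m. (\<Sum>l<m. cnj (U $$ (l, i)) * U $$ (l, j)) = (if i = j then 1 else 0)"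
      using *[OF that] by (metis index_one_mat(1))
  next
    assume "\<forall>i<m. \<forall>j<m. (\<Sum>l<m. cnj (U $$ (l, i)) * U $$ (l, j)) = (if i = j then 1 else 0)"
    thus "mat_adjoint U * U = 1\<^sub>m m"
      using *[OF that] that mat_adjoint_carrier[OF that] by (intro eq_matI) auto
  qed
  thus ?thesis
    by (auto simp: unitary_group_def)
qed

lemma unitary_group_column_norm:
  assumes "U \<in> unitary_group m" "j < m"
  shows "(\<Sum>l<m. (cmod (U $$ (l, j)))\<^sup>2) = 1"
proof -
  have "complex_of_real (\<Sum>l<m. (cmod (U $$ (l, j)))\<^sup>2) = (\<Sum>l<m. cnj (U $$ (l, j)) * U $$ (l, j))"
    by (simp only: of_real_sum complex_norm_square mult.commute)
  also have "\<dots> = 1"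
    using assms by (simp add: unitary_group_iff)
  finally show ?thesis
    by (metis of_real_1 of_real_eq_iff)
qed

lemma unitary_group_entry_le_1:
  assumes "U \<in> unitary_group m" "i < m" "j < m"
  shows "cmod (U $$ (i, j)) \<le> 1"
proof -
  have "(cmod (U $$ (i, j)))\<^sup>2 \<le> (\<Sum>l<m. (cmod (U $$ (l, j)))\<^sup>2)"
    using assms by (intro member_le_sum) auto
  thus ?thesis
    using unitary_group_column_norm[OF assms(1,3)] by (simp add: power_le_one_iff abs_square_le_1)
qed

text \<open>Cross terms vanish by column orthogonality. In the row estimate this evaluates the total
  variance of a sign sum.\<close>

lemma unitary_group_norm_combination:
  assumes "U \<in> unitary_group m" "n \<le> m"
  shows "(\<Sum>l<m. (cmod (\<Sum>j<n. complex_of_real (g j) * U $$ (l, j)))\<^sup>2) = (\<Sum>j<n. (g j)\<^sup>2)"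
proof -
  have "complex_of_real (\<Sum>l<m. (cmod (\<Sum>j<n. complex_of_real (g j) * U $$ (l, j)))\<^sup>2)
      = (\<Sum>l<m. \<Sum>j<n. \<Sum>k<n. (g j * g k) * (cnj (U $$ (l, k)) * U $$ (l, j)))"
    by (simp only: of_real_sum complex_norm_square cnj_sum sum_product complex_cnj_mult
        complex_cnj_complex_of_real mult_ac of_real_mult)
  also have "\<dots> = (\<Sum>j<n. \<Sum>k<n. \<Sum>l<m. (g j * g k) * (cnj (U $$ (l, k)) * U $$ (l, j)))"
    by (subst sum.swap, rule sum.cong[OF refl], subst sum.swap, rule refl)
  also have "\<dots> = (\<Sum>j<n. \<Sum>k<n. (g j * g k) * (\<Sum>l<m. cnj (U $$ (l, k)) * U $$ (l, j)))"
    by (simp add: sum_distrib_left)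
  also have "\<dots> = (\<Sum>j<n. \<Sum>k<n. if k = j then complex_of_real (g j * g k) else 0)"
    using assms by (intro sum.cong) (auto simp: unitary_group_iff)
  also have "\<dots> = complex_of_real (\<Sum>j<n. (g j)\<^sup>2)"
    by (simp add: power2_eq_square)
  finally show ?thesis
    by (simp only: of_real_eq_iff)
qed

section \<open>Fourier matrices with signs\<close>

text \<open>The discrete Fourier matrix with column \<open>l\<close> multiplied by
  \<open>\<epsilon> l\<close>. For signs, all entries have modulus \<open>1 / sqrt m\<close>, so
  each row of a product mixes all rows of the right factor with equal weight. Unlike real Hadamard
  matrices, it exists in every dimension.\<close>

definition signed_dft :: "nat \<Rightarrow> (nat \<Rightarrow> real) \<Rightarrow> complex mat" where
  "signed_dft m \<epsilon> = Matrix.mat m m (\<lambda>(k, l).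
     complex_of_real (\<epsilon> l / sqrt (real m)) * cis (2 * pi * real k * real l / real m))"

text \<open>The summands are powers of an \<open>m\<close>-th root of unity \<open>w\<close>, and
  \<open>0 < \<bar>d\<bar> < m\<close> excludes \<open>w = 1\<close>, so the geometric sum vanishes.
  \<open>d\<close> is an integer because it will be a difference of column indices.\<close>

lemma sum_roots_of_unity:
  fixes d :: int
  assumes "\<bar>d\<bar> < int m" "d \<noteq> 0"
  shows "(\<Sum>k<m. cis (2 * pi * real k * real_of_int d / real m)) = 0"
proof -
  define w where "w = cis (2 * pi * real_of_int d / real m)"
  have m: "m > 0" using assms by auto
  have "w ^ m = cis (real m * (2 * pi * real_of_int d / real m))"
    by (simp only: w_def Complex.DeMoivre)
  also have "real m * (2 * pi * real_of_int d / real m) = 2 * pi * real_of_int d"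
    using m by simp
  also have "cis (2 * pi * real_of_int d) = 1"
    by simp
  finally have wm: "w ^ m = 1" .
  have "w \<noteq> 1"
  proof
    assume "w = 1"
    hence "cos (2 * pi * real_of_int d / real m) = 1"
      by (simp add: w_def complex_eq_iff)
    then obtain q :: int where "2 * pi * real_of_int d / real m = real_of_int q * 2 * pi"
      by (auto simp: cos_one_2pi_int)
    hence "real_of_int d = real_of_int q * real m"
      using m by (simp add: field_simps)
    hence "d = q * int m"
      by (metis of_int_eq_iff of_int_mult of_int_of_nat_eq)
    with assms show False
      by (metis abs_mult abs_of_nat dvd_imp_le_int dvd_triv_right not_less)
  qed
  moreover have "(\<Sum>k<m. cis (2 * pi * real k * real_of_int d / real m)) = (\<Sum>k<m. w ^ k)"
    by (intro sum.cong) (auto simp: w_def Complex.DeMoivre algebra_simps)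
  ultimately show ?thesis
    using wm by (simp add: geometric_sum)
qed

lemma signed_dft_unitary:
  assumes "\<And>l. l < m \<Longrightarrow> \<epsilon> l \<in> {-1, 1}"
  shows "signed_dft m \<epsilon> \<in> unitary_group m"
proof -
  have "(\<Sum>l<m. cnj (signed_dft m \<epsilon> $$ (l, i)) * signed_dft m \<epsilon> $$ (l, j)) = (if i = j then 1 else 0)"
    if ij: "i < m" "j < m" for i j
  proof -
    have "(\<Sum>l<m. cnj (signed_dft m \<epsilon> $$ (l, i)) * signed_dft m \<epsilon> $$ (l, j))
        = (\<Sum>l<m. complex_of_real (\<epsilon> i * \<epsilon> j / real m)
            * cis (2 * pi * real l * real_of_int (int j - int i) / real m))"
    proof (intro sum.cong refl)
      fix l assume "l \<in> {..<m}"
      hence l: "l < m" by simp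
      have "cis (- (2 * pi * real l * real i / real m)) * cis (2 * pi * real l * real j / real m)
          = cis (2 * pi * real l * real_of_int (int j - int i) / real m)"
        by (simp add: cis_mult algebra_simps diff_divide_distrib)
      moreover have "complex_of_real (\<epsilon> i / sqrt (real m)) * complex_of_real (\<epsilon> j / sqrt (real m))
          = complex_of_real (\<epsilon> i * \<epsilon> j / real m)"
        by (simp flip: of_real_mult add: field_simps)
      ultimately show "cnj (signed_dft m \<epsilon> $$ (l, i)) * signed_dft m \<epsilon> $$ (l, j)
        = complex_of_real (\<epsilon> i * \<epsilon> j / real m)
            * cis (2 * pi * real l * real_of_int (int j - int i) / real m)"
        using l ij by (simp add: signed_dft_def cis_cnj mult_ac)
    qed
    also have "\<dots> = complex_of_real (\<epsilon> i * \<epsilon> j / real m)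
        * (\<Sum>l<m. cis (2 * pi * real l * real_of_int (int j - int i) / real m))"
      by (simp add: sum_distrib_left)
    also have "\<dots> = (if i = j then 1 else 0)"
    proof (cases "i = j")
      case True
      then show ?thesis using ij assms[of j] by auto
    next
      case False
      hence "(\<Sum>l<m. cis (2 * pi * real l * real_of_int (int j - int i) / real m)) = 0"
        using ij by (intro sum_roots_of_unity) auto
      then show ?thesis using False by simp
    qed
    finally show ?thesis .
  qed
  thus ?thesis
    by (auto simp: unitary_group_iff) (simp add: signed_dft_def)
qed

section \<open>Exponential moments of signs and discrete Gaussian sums\<close>

text \<open>Hoeffding's lemma for a fair sign: the values \<open>-b\<close> and \<open>b\<close>
  span an interval of length \<open>2 * b\<close>, and
  \<open>(2 * b)\<^sup>2 / 8 = b\<^sup>2 / 2\<close>. Negative \<open>b\<close> follows by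
  evenness.\<close>

lemma cosh_le_exp_square:
  fixes b :: real
  shows "exp b + exp (- b) \<le> 2 * exp (b\<^sup>2 / 2)"
proof -
  have *: "exp b + exp (- b) \<le> 2 * exp (b\<^sup>2 / 2)" if "b \<ge> 0" for b :: real
  proof -
    have pos: "1 + 1 / 2 * (exp (2 * b) - 1) > 0"
    proof -
      have "0 < (1 + exp (2 * b)) / 2"
        by (intro divide_pos_pos add_pos_pos) auto
      thus ?thesis by (simp add: field_simps)
    qed
    have "- (2 * b) * (1 / 2) + ln (1 + 1 / 2 * (exp (2 * b) - 1)) \<le> (2 * b)\<^sup>2 / 8"
      using that by (intro Hoeffdings_lemma_aux) auto
    hence "ln (1 + 1 / 2 * (exp (2 * b) - 1)) \<le> b + b\<^sup>2 / 2"
      by (simp add: power_mult_distrib)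
    hence *: "1 + 1 / 2 * (exp (2 * b) - 1) \<le> exp (b + b\<^sup>2 / 2)"
      using pos by (metis exp_le_cancel_iff exp_ln)
    have "exp (- b) * (1 + exp (2 * b)) \<le> exp (- b) * (2 * exp (b + b\<^sup>2 / 2))"
    proof (intro mult_left_mono)
      have "1 + e \<le> 2 * d" if "1 + 1 / 2 * (e - 1) \<le> d" for d e :: real
        using that by (simp add: field_simps)
      from this[OF *] show "1 + exp (2 * b) \<le> 2 * exp (b + b\<^sup>2 / 2)" .
    qed simp
    thus ?thesis
      by (simp add: algebra_simps flip: exp_add)
  qed
  show ?thesis
    using *[of b] *[of "- b"] by (cases "b \<ge> 0") (auto simp: add.commute)
qed

text \<open>Independence of the signs in finite form: the sum over sign vectors factorises over
  coordinates. Summing over signs instead of drawing them avoids a product space with Haar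
  measure.\<close>

lemma sum_signs_exp_le:
  fixes b :: "nat \<Rightarrow> real"
  shows "(\<Sum>\<epsilon>\<in>PiE {..<m} (\<lambda>_. {-1, 1}). exp (\<Sum>l<m. \<epsilon> l * b l)) \<le> 2 ^ m * exp ((\<Sum>l<m. (b l)\<^sup>2) / 2)"
proof -
  have "(\<Sum>\<epsilon>\<in>PiE {..<m} (\<lambda>_. {-1, 1}). exp (\<Sum>l<m. \<epsilon> l * b l))
      = (\<Prod>l<m. \<Sum>e\<in>{-1, 1}. exp (e * b l))"
    by (subst prod_sum_PiE) (auto simp: exp_sum)
  also have "\<dots> \<le> (\<Prod>l<m. 2 * exp ((b l)\<^sup>2 / 2))"
    using cosh_le_exp_square by (intro prod_mono) (auto intro: add_nonneg_nonneg simp: add.commute)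
  also have "\<dots> = 2 ^ m * exp ((\<Sum>l<m. (b l)\<^sup>2) / 2)"
    by (simp add: prod.distrib exp_sum sum_divide_distrib)
  finally show ?thesis .
qed

text \<open>
  Discrete substitute for \<^term>\<open>exp (x\<^sup>2 / 4)\<close> being the exponential moment of a Gaussian: keep the
  integer nearest to the maximiser \<open>x / 2\<close>. It avoids product integrals.
\<close>

lemma exp_square_le_sum_exp:
  fixes x :: real
  assumes "\<bar>x\<bar> \<le> real_of_int N" "N \<ge> 1"
  shows "exp (x\<^sup>2 / 4 - 1 / 4) \<le> (\<Sum>k\<in>{-N..N}. exp (real_of_int k * x - (real_of_int k)\<^sup>2))"
proof -
  have one_le_N: "1 \<le> real_of_int N"
    using assms(2) by simp
  define k where "k = round (x / 2)"
  have k: "\<bar>real_of_int k - x / 2\<bar> \<le> 1 / 2"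
    unfolding k_def by (rule of_int_round_abs_le)
  \<comment> \<open>Since \<open>k * x - k\<^sup>2 = x\<^sup>2 / 4 - (k - x / 2)\<^sup>2\<close>,
    rounding costs at most \<open>1 / 4\<close> in the exponent.\<close>
  have "(real_of_int k - x / 2)\<^sup>2 \<le> (1 / 2)\<^sup>2"
    using k by (intro abs_le_square_iff[THEN iffD1]) simp
  hence "x\<^sup>2 / 4 - 1 / 4 \<le> real_of_int k * x - (real_of_int k)\<^sup>2"
    by (simp add: power2_eq_square field_simps)
  \<comment> \<open>\<open>\<bar>k\<bar> \<le> \<bar>x\<bar> / 2 + 1 / 2 \<le> (N + 1) / 2 \<le>
    N\<close>, the last step by \<open>N \<ge> 1\<close>.\<close>
  moreover have "k \<in> {-N..N}"
  proof -
    have "real_of_int (- N) \<le> real_of_int k" "real_of_int k \<le> real_of_int N"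
      using k assms(1) one_le_N unfolding abs_le_iff of_int_minus by linarith+
    thus ?thesis by simp
  qed
  ultimately have "exp (x\<^sup>2 / 4 - 1 / 4) \<le> exp (real_of_int k * x - (real_of_int k)\<^sup>2)"
    by simp
  also have "\<dots> \<le> (\<Sum>k\<in>{-N..N}. exp (real_of_int k * x - (real_of_int k)\<^sup>2))"
    using \<open>k \<in> {-N..N}\<close> by (intro member_le_sum) auto
  finally show ?thesis .
qed

text \<open>On integers \<open>k\<^sup>2 \<ge> \<bar>k\<bar>\<close>, so two geometric series of
  ratio \<open>exp (- 1 / 2) \<le> 2 / 3\<close> dominate the sum, each at most 3; zero is counted
  twice. A constant independent of \<open>N\<close> is all that is required.\<close>

lemma sum_exp_neg_square_le:
  "(\<Sum>k\<in>{-N..N::int}. exp (- (real_of_int k)\<^sup>2 / 2)) \<le> 6"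
proof (cases "N \<ge> 0")
  case True
  define q :: real where "q = exp (- 1 / 2)"
  have q: "0 \<le> q" "q \<le> 2 / 3"
  proof -
    have "3 / 2 \<le> exp (1 / 2 :: real)"
      using exp_ge_add_one_self[of "1 / 2 :: real"] by simp
    hence "q * (3 / 2) \<le> q * exp (1 / 2)"
      by (intro mult_left_mono) (auto simp: q_def)
    thus "q \<le> 2 / 3" by (simp add: q_def flip: exp_add)
  qed (simp add: q_def)
  have "(\<Sum>k\<in>{-N..N}. exp (- (real_of_int k)\<^sup>2 / 2)) \<le> (\<Sum>k\<in>{-N..N}. q ^ nat \<bar>k\<bar>)"
  proof (intro sum_mono)
    fix k :: int
    have "\<bar>k\<bar> * 1 \<le> \<bar>k\<bar> * \<bar>k\<bar>"
    proof (cases "k = 0")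
      case False
      thus ?thesis by (intro mult_left_mono) linarith+
    qed simp
    hence "\<bar>k\<bar> \<le> k\<^sup>2" by (simp only: power2_eq_square abs_mult_self_eq mult_1_right)
    hence "real_of_int \<bar>k\<bar> \<le> (real_of_int k)\<^sup>2"
      by (metis of_int_le_iff of_int_power)
    thus "exp (- (real_of_int k)\<^sup>2 / 2) \<le> q ^ nat \<bar>k\<bar>"
      by (simp add: q_def flip: exp_of_nat_mult)
  qed
  also have "\<dots> \<le> (\<Sum>k\<in>int ` {..nat N} \<union> (\<lambda>i. - int i) ` {..nat N}. q ^ nat \<bar>k\<bar>)"
  proof (intro sum_mono2)
    show "{-N..N} \<subseteq> int ` {..nat N} \<union> (\<lambda>i. - int i) ` {..nat N}"
    proof
      fix k assume k: "k \<in> {-N..N}"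
      show "k \<in> int ` {..nat N} \<union> (\<lambda>i. - int i) ` {..nat N}"
      proof (cases "k \<ge> 0")
        case True
        hence "k = int (nat k)" "nat k \<le> nat N" using k by auto
        thus ?thesis by blast
      next
        case False
        hence "k = - int (nat (- k))" "nat (- k) \<le> nat N" using k by auto
        thus ?thesis by blast
      qed
    qed
  qed (use q in auto)
  also have "\<dots> \<le> (\<Sum>k\<in>int ` {..nat N}. q ^ nat \<bar>k\<bar>) + (\<Sum>k\<in>(\<lambda>i. - int i) ` {..nat N}. q ^ nat \<bar>k\<bar>)"
    using q by (subst sum.union_inter[symmetric]) (auto intro!: sum_nonneg)
  also have "\<dots> = 2 * (\<Sum>i\<le>nat N. q ^ i)"
    by (simp add: sum.reindex inj_on_def)
  also have "(\<Sum>i\<le>nat N. q ^ i) = (\<Sum>i<Suc (nat N). q ^ i)"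
    by (simp add: lessThan_Suc_atMost)
  also have "\<dots> = (1 - q ^ Suc (nat N)) / (1 - q)"
    using q by (subst sum_gp_strict) auto
  also have "\<dots> \<le> 1 / (1 / 3)"
    using q by (intro frac_le) auto
  finally show ?thesis by simp
qed auto

section \<open>Left invariance of Haar measure and subgaussian rows\<close>

lemma is_haar_measureD:
  assumes "is_haar_measure m \<mu>"
  shows "prob_space \<mu>" "space \<mu> = unitary_group m" "sets \<mu> = sets (unitary_borel m)"
    "\<And>V. V \<in> unitary_group m \<Longrightarrow> distr \<mu> \<mu> (\<lambda>U. V * U) = \<mu>"
  using assms by (auto simp: is_haar_measure_def)

lemma entry_measurable:
  assumes "i < m" "j < m"
  shows "(\<lambda>U. U $$ (i, j)) \<in> borel_measurable (unitary_borel m)"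
proof -
  have "(\<lambda>x. x (i, j)) \<circ> (\<lambda>U. \<lambda>(i, j) \<in> {..<m} \<times> {..<m}. U $$ (i, j))
      \<in> unitary_borel m \<rightarrow>\<^sub>M (borel :: complex measure)"
    unfolding unitary_borel_def
    by (rule measurable_comp[OF measurable_vimage_algebra1 measurable_component_singleton])
      (use assms in \<open>auto simp: space_PiM PiE_def extensional_def\<close>)
  thus ?thesis
    using assms by (simp add: comp_def)
qed

text \<open>Entries of \<open>V * U\<close> are linear in those of \<open>U\<close>. Measurability
  of the translation is what turns invariance of the measure into a change of variables under the
  integral.\<close>

lemma mult_unitary_measurable:
  assumes V: "V \<in> unitary_group m"
  shows "(\<lambda>U. V * U) \<in> unitary_borel m \<rightarrow>\<^sub>M unitary_borel m"
proof -
  have "(\<lambda>U. \<lambda>(i, j) \<in> {..<m} \<times> {..<m}. (V * U) $$ (i, j))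
      \<in> unitary_borel m \<rightarrow>\<^sub>M (\<Pi>\<^sub>M ij \<in> {..<m} \<times> {..<m}. (borel :: complex measure))"
  proof (rule measurable_PiM_single')
    fix ij assume "ij \<in> {..<m} \<times> {..<m}"
    then obtain i j where ij: "ij = (i, j)" "i < m" "j < m" by auto
    have "(\<lambda>U. \<Sum>k<m. V $$ (i, k) * U $$ (k, j)) \<in> borel_measurable (unitary_borel m)"
      using ij by (intro borel_measurable_sum borel_measurable_times entry_measurable) auto
    also have "?this \<longleftrightarrow> (\<lambda>U. (\<lambda>(i, j) \<in> {..<m} \<times> {..<m}. (V * U) $$ (i, j)) ij)
        \<in> borel_measurable (unitary_borel m)"
      using V ij by (intro measurable_cong)
        (auto simp: unitary_borel_def unitary_group_def scalar_prod_def atLeast0LessThan)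
    finally show "(\<lambda>U. (\<lambda>(i, j) \<in> {..<m} \<times> {..<m}. (V * U) $$ (i, j)) ij)
        \<in> borel_measurable (unitary_borel m)" .
  qed (auto simp: space_PiM PiE_def extensional_def)
  hence "(\<lambda>U. V * U) \<in> unitary_borel m \<rightarrow>\<^sub>M vimage_algebra (unitary_group m)
     (\<lambda>U. \<lambda>(i, j) \<in> {..<m} \<times> {..<m}. U $$ (i, j))
     (\<Pi>\<^sub>M ij \<in> {..<m} \<times> {..<m}. (borel :: complex measure))"
    by (intro measurable_vimage_algebra2)
      (use V in \<open>auto simp: unitary_borel_def intro: unitary_group_mult\<close>)
  thus ?thesis
    by (simp only: unitary_borel_def)
qed

lemma haar_integral_mult_left:
  fixes F :: "complex mat \<Rightarrow> real"
  assumes haar: "is_haar_measure m \<mu>" and V: "V \<in> unitary_group m"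
    and F: "F \<in> borel_measurable (unitary_borel m)"
  shows "(\<integral>U. F (V * U) \<partial>\<mu>) = (\<integral>U. F U \<partial>\<mu>)"
proof -
  note D = is_haar_measureD[OF haar]
  have V_meas: "(\<lambda>U. V * U) \<in> \<mu> \<rightarrow>\<^sub>M \<mu>"
    using mult_unitary_measurable[OF V] D(3) by (simp cong: measurable_cong_sets)
  have F_meas: "F \<in> borel_measurable \<mu>"
    using F D(3) by (simp cong: measurable_cong_sets)
  have "(\<integral>U. F U \<partial>\<mu>) = (\<integral>U. F U \<partial>distr \<mu> \<mu> (\<lambda>U. V * U))"
    using D(4)[OF V] by simp
  also have "\<dots> = (\<integral>U. F (V * U) \<partial>\<mu>)"
    by (rule integral_distr[OF V_meas F_meas])
  finally show ?thesis by simp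
qed

lemma signed_dft_mult_index:
  assumes "U \<in> unitary_group m" "i < m" "j < m"
  shows "(signed_dft m \<epsilon> * U) $$ (i, j) = (\<Sum>l<m.
      complex_of_real (\<epsilon> l / sqrt (real m)) * cis (2 * pi * real i * real l / real m) * U $$ (l, j))"
  using assms by (auto simp: signed_dft_def unitary_group_def scalar_prod_def atLeast0LessThan)

text \<open>
  Left multiplication by a randomly signed Fourier matrix replaces the entries of one row by
  Rademacher sums of whole columns, and these are subgaussian.
\<close>

lemma haar_row_subgaussian:
  fixes g :: "nat \<Rightarrow> real" and z :: complex
  assumes haar: "is_haar_measure m \<mu>" and i: "i < m" and n: "n \<le> m" and z: "cmod z = 1"
  shows "(\<integral>U. exp (\<Sum>j<n. g j * Re (z * U $$ (i, j))) \<partial>\<mu>) \<le> exp ((\<Sum>j<n. (g j)\<^sup>2) / (2 * real m))"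
proof -
  note D = is_haar_measureD[OF haar]
  interpret prob_space \<mu> by (rule D(1))
  have Re_real_mult: "Re (complex_of_real r * x) = r * Re x" for r x
    by simp
  define F where "F U = exp (\<Sum>j<n. g j * Re (z * U $$ (i, j)))" for U :: "complex mat"
  \<comment> \<open>\<open>w l\<close> collects all phases, of modulus 1, and \<open>b U l\<close>
    is the coefficient of the sign \<open>\<epsilon> l\<close> in the exponent after translation.
    The free phase \<open>z\<close> serves to treat real and imaginary parts together.\<close>
  define w where "w l = z * cis (2 * pi * real i * real l / real m)" for l
  define b where "b U l = Re (w l * (\<Sum>j<n. complex_of_real (g j) * U $$ (l, j))) / sqrt (real m)"
    for U :: "complex mat" and l
  let ?S = "PiE {..<m} (\<lambda>_. {-1, 1}) :: (nat \<Rightarrow> real) set"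
  have cardS: "card ?S = 2 ^ m"
    by (simp add: card_PiE numeral_2_eq_2)
  have F_meas: "F \<in> borel_measurable (unitary_borel m)"
  proof -
    have [measurable]: "(\<lambda>U. U $$ (i, j)) \<in> borel_measurable (unitary_borel m)" if "j \<in> {..<n}" for j
      using that i n by (intro entry_measurable) auto
    show ?thesis unfolding F_def by measurable
  qed
  have unit: "signed_dft m \<epsilon> \<in> unitary_group m" if "\<epsilon> \<in> ?S" for \<epsilon>
    using that by (intro signed_dft_unitary) (auto simp: PiE_def Pi_def)
  have F_dft: "F (signed_dft m \<epsilon> * U) = exp (\<Sum>l<m. \<epsilon> l * b U l)"
    if "U \<in> unitary_group m" for \<epsilon> U
  proof -
    have "(\<Sum>j<n. g j * Re (z * (signed_dft m \<epsilon> * U) $$ (i, j)))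
        = (\<Sum>j<n. \<Sum>l<m. \<epsilon> l * (Re (w l * (complex_of_real (g j) * U $$ (l, j))) / sqrt (real m)))"
    proof (intro sum.cong refl)
      fix j assume "j \<in> {..<n}"
      hence j: "j < m" using n by auto
      have "g j * Re (z * (signed_dft m \<epsilon> * U) $$ (i, j))
          = Re (\<Sum>l<m. complex_of_real (\<epsilon> l / sqrt (real m)) * (w l * (complex_of_real (g j) * U $$ (l, j))))"
        unfolding signed_dft_mult_index[OF that i j] w_def Re_real_mult[of "g j", symmetric] sum_distrib_left
        by (intro arg_cong[of _ _ Re] sum.cong refl) (simp only: mult_ac)
      also have "\<dots> = (\<Sum>l<m. \<epsilon> l * (Re (w l * (complex_of_real (g j) * U $$ (l, j))) / sqrt (real m)))"
        unfolding Re_sum Re_real_mult by (simp only: times_divide_eq_left times_divide_eq_right)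
      finally show "g j * Re (z * (signed_dft m \<epsilon> * U) $$ (i, j)) = \<dots>" .
    qed
    also have "\<dots> = (\<Sum>l<m. \<epsilon> l * b U l)"
      by (subst sum.swap) (simp only: b_def sum_distrib_left Re_sum sum_divide_distrib)
    finally show ?thesis by (simp add: F_def)
  qed
  have F_bound: "norm (F U) \<le> exp (\<Sum>j<n. \<bar>g j\<bar>)" if "U \<in> unitary_group m" for U
  proof -
    have "g j * Re (z * U $$ (i, j)) \<le> \<bar>g j\<bar>" if "j < n" for j
    proof -
      have "\<bar>Re (z * U $$ (i, j))\<bar> \<le> cmod (z * U $$ (i, j))"
        by (rule abs_Re_le_cmod)
      also have "\<dots> \<le> 1"
        using unitary_group_entry_le_1[OF \<open>U \<in> unitary_group m\<close> i, of j] that n z by (simp add: norm_mult)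
      finally have "\<bar>g j\<bar> * \<bar>Re (z * U $$ (i, j))\<bar> \<le> \<bar>g j\<bar> * 1"
        by (intro mult_left_mono) auto
      thus ?thesis by (metis abs_ge_self abs_mult mult.right_neutral order_trans)
    qed
    hence "(\<Sum>j<n. g j * Re (z * U $$ (i, j))) \<le> (\<Sum>j<n. \<bar>g j\<bar>)"
      by (intro sum_mono) blast
    thus ?thesis by (simp only: F_def real_norm_def abs_exp_cancel exp_le_cancel_iff)
  qed
  have meas: "(\<lambda>U. F (V * U)) \<in> borel_measurable \<mu>" if "V \<in> unitary_group m" for V
  proof -
    have "(\<lambda>U. F (V * U)) \<in> borel_measurable (unitary_borel m)"
      using measurable_compose[OF mult_unitary_measurable[OF that] F_meas] .
    thus ?thesis using D(3) by (simp cong: measurable_cong_sets)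
  qed
  have int: "integrable \<mu> (\<lambda>U. F (V * U))" if V: "V \<in> unitary_group m" for V
  proof (rule integrable_const_bound[where B = "exp (\<Sum>j<n. \<bar>g j\<bar>)"])
    show "AE U in \<mu>. norm (F (V * U)) \<le> exp (\<Sum>j<n. \<bar>g j\<bar>)"
      using D(2) by (intro AE_I2 F_bound unitary_group_mult[OF V]) simp
  qed (rule meas[OF V])
  \<comment> \<open>All \<open>2 ^ m\<close> translates have the same integral by invariance, so
    their sum may be bounded pointwise in \<open>U\<close>.\<close>
  have "2 ^ m * (\<integral>U. F U \<partial>\<mu>) = (\<Sum>\<epsilon>\<in>?S. \<integral>U. F U \<partial>\<mu>)"
    by (simp only: sum_constant cardS of_nat_power of_nat_numeral)
  also have "\<dots> = (\<Sum>\<epsilon>\<in>?S. \<integral>U. F (signed_dft m \<epsilon> * U) \<partial>\<mu>)"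
    by (intro sum.cong refl haar_integral_mult_left[OF haar unit F_meas, symmetric])
  also have "\<dots> = (\<integral>U. (\<Sum>\<epsilon>\<in>?S. F (signed_dft m \<epsilon> * U)) \<partial>\<mu>)"
    by (intro Bochner_Integration.integral_sum[symmetric] int unit)
  also have "\<dots> \<le> (\<integral>U. 2 ^ m * exp ((\<Sum>j<n. (g j)\<^sup>2) / (2 * real m)) \<partial>\<mu>)"
  proof (rule integral_mono)
    fix U assume "U \<in> space \<mu>"
    hence U: "U \<in> unitary_group m" using D(2) by simp
    have m0: "real m > 0" using i by simp
    \<comment> \<open>Passing from the real part to the modulus turns the sum over \<open>l\<close>
      into a norm that unitarity evaluates exactly.\<close>
    have "(b U l)\<^sup>2 \<le> (cmod (\<Sum>j<n. complex_of_real (g j) * U $$ (l, j)))\<^sup>2 / real m" for l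
    proof -
      define v where "v = (\<Sum>j<n. complex_of_real (g j) * U $$ (l, j))"
      have "\<bar>Re (w l * v)\<bar> \<le> cmod (w l * v)"
        by (rule abs_Re_le_cmod)
      also have "\<dots> = cmod v"
        by (simp add: norm_mult w_def z)
      finally have "\<bar>Re (w l * v)\<bar>\<^sup>2 \<le> (cmod v)\<^sup>2"
        by (intro power_mono) auto
      hence "(Re (w l * v))\<^sup>2 / real m \<le> (cmod v)\<^sup>2 / real m"
        using m0 by (intro divide_right_mono) (simp_all only: power2_abs less_imp_le)
      moreover have "(b U l)\<^sup>2 = (Re (w l * v))\<^sup>2 / real m"
        using m0 by (simp only: b_def v_def power_divide real_sqrt_pow2 less_imp_le)
      ultimately show ?thesis by (simp only: v_def)
    qed
    hence "(\<Sum>l<m. (b U l)\<^sup>2) \<le> (\<Sum>l<m. (cmod (\<Sum>j<n. complex_of_real (g j) * U $$ (l, j)))\<^sup>2 / real m)"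
      by (rule sum_mono)
    also have "\<dots> = (\<Sum>j<n. (g j)\<^sup>2) / real m"
      unfolding sum_divide_distrib[symmetric] unitary_group_norm_combination[OF U n] ..
    finally have b_le: "(\<Sum>l<m. (b U l)\<^sup>2) / 2 \<le> (\<Sum>j<n. (g j)\<^sup>2) / (2 * real m)"
      by simp
    have "(\<Sum>\<epsilon>\<in>?S. F (signed_dft m \<epsilon> * U)) = (\<Sum>\<epsilon>\<in>?S. exp (\<Sum>l<m. \<epsilon> l * b U l))"
      by (intro sum.cong refl F_dft[OF U])
    also have "\<dots> \<le> 2 ^ m * exp ((\<Sum>l<m. (b U l)\<^sup>2) / 2)"
      by (rule sum_signs_exp_le)
    also have "\<dots> \<le> 2 ^ m * exp ((\<Sum>j<n. (g j)\<^sup>2) / (2 * real m))"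
      using b_le by (intro mult_left_mono) simp_all
    finally show "(\<Sum>\<epsilon>\<in>?S. F (signed_dft m \<epsilon> * U)) \<le> 2 ^ m * exp ((\<Sum>j<n. (g j)\<^sup>2) / (2 * real m))" .
  qed (simp_all add: int unit)
  also have "\<dots> = 2 ^ m * exp ((\<Sum>j<n. (g j)\<^sup>2) / (2 * real m))"
    by (simp add: prob_space)
  finally show ?thesis
    by (simp add: F_def)
qed

text \<open>A Chernoff bound with exponent \<open>m / 4\<close> on a sum of squares. The coordinates
  are dependent, so the exponential is first dominated by a sum over integer vectors
  \<open>k\<close> of exponentials of linear forms, to which the joint subgaussian bound applies.
  Per coordinate, the weight \<open>exp (- k\<^sup>2)\<close> against the moment
  \<open>exp (k\<^sup>2 / 2)\<close> leaves the summable
  \<open>exp (- k\<^sup>2 / 2)\<close>.\<close>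

lemma haar_row_part_tail:
  assumes haar: "is_haar_measure m \<mu>" and i: "i < m" and n: "n \<le> m" and z: "cmod z = 1"
  shows "measure \<mu> {U \<in> space \<mu>. t < (\<Sum>j<n. (Re (z * U $$ (i, j)))\<^sup>2)} \<le> exp (3 * real n - real m * t / 4)"
proof -
  note D = is_haar_measureD[OF haar]
  interpret prob_space \<mu> by (rule D(1))
  define X where "X U j = Re (z * U $$ (i, j))" for U :: "complex mat" and j
  let ?s = "sqrt (real m)"
  \<comment> \<open>The scaled coordinates satisfy
    \<open>\<bar>?s * X U j\<bar> \<le> sqrt m \<le> m\<close>, so integers up to \<open>m\<close>
    suffice.\<close>
  let ?K = "PiE {..<n} (\<lambda>_. {- int m..int m})"
  define G where "G k U = exp (\<Sum>j<n. ?s * real_of_int (k j) * X U j)" for k :: "nat \<Rightarrow> int" and U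
  define c where "c k = exp (- (\<Sum>j<n. (real_of_int (k j))\<^sup>2))" for k :: "nat \<Rightarrow> int"
  have m0: "real m > 0" using i by simp
  have X_meas: "(\<lambda>U. X U j) \<in> borel_measurable \<mu>" if "j \<in> {..<n}" for j
  proof -
    have "(\<lambda>U. U $$ (i, j)) \<in> borel_measurable (unitary_borel m)"
      using that i n by (intro entry_measurable) auto
    hence [measurable]: "(\<lambda>U. U $$ (i, j)) \<in> borel_measurable \<mu>"
      using D(3) by (simp cong: measurable_cong_sets)
    show ?thesis unfolding X_def by measurable
  qed
  have X_bound: "\<bar>X U j\<bar> \<le> 1" if "U \<in> space \<mu>" "j < n" for U j
  proof -
    have "\<bar>X U j\<bar> \<le> cmod (z * U $$ (i, j))"
      unfolding X_def by (rule abs_Re_le_cmod)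
    also have "\<dots> \<le> 1"
      using unitary_group_entry_le_1[of U m i j] that i n z D(2) by (simp add: norm_mult)
    finally show ?thesis .
  qed
  have G_int: "integrable \<mu> (G k)" for k
  proof (rule integrable_const_bound[where B = "exp (\<Sum>j<n. \<bar>?s * real_of_int (k j)\<bar>)"])
    have "?s * real_of_int (k j) * X U j \<le> \<bar>?s * real_of_int (k j)\<bar>" if "U \<in> space \<mu>" "j < n" for U j
    proof -
      have "\<bar>?s * real_of_int (k j)\<bar> * \<bar>X U j\<bar> \<le> \<bar>?s * real_of_int (k j)\<bar> * 1"
        using X_bound[OF that] by (intro mult_left_mono) auto
      thus ?thesis by (simp flip: abs_mult)
    qed
    thus "AE U in \<mu>. norm (G k U) \<le> exp (\<Sum>j<n. \<bar>?s * real_of_int (k j)\<bar>)"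
      by (auto simp: G_def intro!: AE_I2 sum_mono)
    show "G k \<in> borel_measurable \<mu>"
      unfolding G_def using X_meas by measurable
  qed
  let ?A = "{U \<in> space \<mu>. t < (\<Sum>j<n. (X U j)\<^sup>2)}"
  have A: "?A \<in> sets \<mu>"
    using X_meas by measurable
  have "exp (real m * t / 4 - real n / 4) * measure \<mu> ?A
      = (\<integral>U. exp (real m * t / 4 - real n / 4) * indicator ?A U \<partial>\<mu>)"
    using A by simp
  also have "\<dots> \<le> (\<integral>U. (\<Sum>k\<in>?K. c k * G k U) \<partial>\<mu>)"
  proof (rule integral_mono)
    fix U assume U: "U \<in> space \<mu>"
    show "exp (real m * t / 4 - real n / 4) * indicator ?A U \<le> (\<Sum>k\<in>?K. c k * G k U)"
    proof (cases "U \<in> ?A")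
      case True
      have "exp (real m * t / 4 - real n / 4) \<le> exp (\<Sum>j<n. (?s * X U j)\<^sup>2 / 4 - 1 / 4)"
        using True m0 by (simp add: power_mult_distrib sum_subtractf flip: sum_divide_distrib sum_distrib_left)
      also have "\<dots> = (\<Prod>j<n. exp ((?s * X U j)\<^sup>2 / 4 - 1 / 4))"
        by (simp add: exp_sum)
      also have "\<dots> \<le> (\<Prod>j<n. \<Sum>k\<in>{- int m..int m}. exp (real_of_int k * (?s * X U j) - (real_of_int k)\<^sup>2))"
      proof (intro prod_mono conjI exp_square_le_sum_exp)
        fix j assume "j \<in> {..<n}"
        hence "\<bar>?s * X U j\<bar> \<le> ?s * 1"
          unfolding abs_mult using X_bound[OF U, of j] m0 by (intro mult_mono) auto
        also have "?s \<le> real m"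
          using m0 by (intro real_le_lsqrt) (auto simp: power2_eq_square)
        finally show "\<bar>?s * X U j\<bar> \<le> real_of_int (int m)" by simp
      qed (use i in auto)
      also have "\<dots> = (\<Sum>k\<in>?K. \<Prod>j<n. exp (real_of_int (k j) * (?s * X U j) - (real_of_int (k j))\<^sup>2))"
        by (rule prod_sum_PiE) auto
      also have "\<dots> = (\<Sum>k\<in>?K. c k * G k U)"
        by (simp add: c_def G_def sum_subtractf mult_ac flip: exp_sum exp_add)
      finally show ?thesis using True by simp
    next
      case False
      thus ?thesis by (simp add: c_def G_def sum_nonneg)
    qed
  qed (use A G_int in \<open>auto intro!: integrable_real_indicator simp: emeasure_eq_measure\<close>)
  also have "\<dots> = (\<Sum>k\<in>?K. c k * (\<integral>U. G k U \<partial>\<mu>))"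
    using G_int by (subst Bochner_Integration.integral_sum) auto
  also have "\<dots> \<le> (\<Sum>k\<in>?K. \<Prod>j<n. exp (- (real_of_int (k j))\<^sup>2 / 2))"
  proof (rule sum_mono)
    fix k
    have "(\<integral>U. G k U \<partial>\<mu>) \<le> exp ((\<Sum>j<n. (?s * real_of_int (k j))\<^sup>2) / (2 * real m))"
      unfolding G_def X_def by (rule haar_row_subgaussian[OF haar i n z])
    also have "\<dots> = exp ((\<Sum>j<n. (real_of_int (k j))\<^sup>2) / 2)"
      using m0 by (simp add: power_mult_distrib flip: sum_distrib_left)
    finally have "c k * (\<integral>U. G k U \<partial>\<mu>) \<le> c k * exp ((\<Sum>j<n. (real_of_int (k j))\<^sup>2) / 2)"
      by (intro mult_left_mono) (auto simp: c_def)
    also have "\<dots> = (\<Prod>j<n. exp (- (real_of_int (k j))\<^sup>2 / 2))"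
      by (simp add: c_def sum_negf flip: exp_sum exp_add sum_divide_distrib)
    finally show "c k * (\<integral>U. G k U \<partial>\<mu>) \<le> (\<Prod>j<n. exp (- (real_of_int (k j))\<^sup>2 / 2))" .
  qed
  also have "\<dots> = (\<Prod>j<n. \<Sum>k\<in>{- int m..int m}. exp (- (real_of_int k)\<^sup>2 / 2))"
    by (rule prod_sum_PiE[symmetric]) auto
  also have "\<dots> \<le> 6 ^ n"
    using sum_exp_neg_square_le[of "int m"] by (auto intro!: power_mono sum_nonneg)
  \<comment> \<open>\<open>11 / 4\<close> completes the rounding loss \<open>1 / 4\<close> per
    coordinate to 3, and already \<open>1 + 11 / 4 + (11 / 4)\<^sup>2 / 2\<close> exceeds 6.\<close>
  also have "\<dots> \<le> exp (11 / 4) ^ n"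
    using exp_lower_Taylor_quadratic[of "11 / 4"] by (intro power_mono) (auto simp: power2_eq_square)
  also have "\<dots> = exp (3 * real n - real n / 4)"
    by (simp flip: exp_of_nat_mult)
  finally have "exp (- (real m * t / 4 - real n / 4)) * (exp (real m * t / 4 - real n / 4) * measure \<mu> ?A)
      \<le> exp (- (real m * t / 4 - real n / 4)) * exp (3 * real n - real n / 4)"
    by (intro mult_left_mono) auto
  also have "\<dots> = exp (3 * real n - real m * t / 4)"
    by (simp flip: exp_add add: algebra_simps)
  finally have "measure \<mu> ?A \<le> exp (3 * real n - real m * t / 4)"
    by (simp add: mult.assoc[symmetric] flip: exp_add)
  thus ?thesis by (simp only: X_def)
qed

section \<open>Unitaries with evenly spread rows\<close>

definition row_mass :: "nat \<Rightarrow> complex mat \<Rightarrow> nat \<Rightarrow> real" where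
  "row_mass n U i = (\<Sum>j<n. (cmod (U $$ (i, j)))\<^sup>2)"

text \<open>The event E. The threshold serves twice: \<open>n * r \<le> 1 / 4\<close> for each row
  mass \<open>r\<close> bounds every factor of a permanent, and together with total mass
  \<open>n\<close> it bounds the sum of the squared masses by \<open>1 / 4\<close>.\<close>

definition spread_unitaries :: "nat \<Rightarrow> nat \<Rightarrow> complex mat set" where
  "spread_unitaries m n = {U \<in> unitary_group m. \<forall>i<m. row_mass n U i \<le> 1 / (4 * real n)}"

text \<open>Multiplying by \<open>\<i>\<close> turns minus the imaginary part into the real part, so
  a row mass splits into the sums for \<open>z = 1\<close> and \<open>z = \<i>\<close>, one of which
  exceeds \<open>1 / (8 * n)\<close> if the mass exceeds \<open>1 / (4 * n)\<close>. A union bound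
  over \<open>m\<close> rows and two parts gives the factor \<open>2 * m\<close>.\<close>

lemma haar_spread_unitaries:
  assumes haar: "is_haar_measure m \<mu>" and n: "n \<le> m"
  shows "spread_unitaries m n \<in> sets \<mu>"
    and "measure \<mu> (spread_unitaries m n) \<ge> 1 - 2 * real m * exp (3 * real n - real m / (32 * real n))"
proof -
  note D = is_haar_measureD[OF haar]
  interpret prob_space \<mu> by (rule D(1))
  have entry: "(\<lambda>U. U $$ (i, j)) \<in> borel_measurable \<mu>" if "i \<in> {..<m}" "j \<in> {..<n}" for i j
    using entry_measurable[of i m j] that n D(3) by (simp cong: measurable_cong_sets)
  define B where "B i z = {U \<in> space \<mu>. 1 / (8 * real n) < (\<Sum>j<n. (Re (z * U $$ (i, j)))\<^sup>2)}" for i z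
  have B: "B i z \<in> sets \<mu>" if "i < m" for i z
  proof -
    have [measurable]: "(\<lambda>U. U $$ (i, j)) \<in> borel_measurable \<mu>" if "j \<in> {..<n}" for j
      using entry[of i, OF _ that] \<open>i < m\<close> by simp
    show ?thesis unfolding B_def by measurable
  qed
  have eq: "spread_unitaries m n = {U \<in> space \<mu>. \<forall>i\<in>{..<m}. row_mass n U i \<le> 1 / (4 * real n)}"
    using D(2) by (auto simp: spread_unitaries_def)
  have meas: "(\<lambda>U. row_mass n U i) \<in> borel_measurable \<mu>" if "i \<in> {..<m}" for i
  proof -
    have [measurable]: "(\<lambda>U. U $$ (i, j)) \<in> borel_measurable \<mu>" if "j \<in> {..<n}" for j
      using entry[OF \<open>i \<in> {..<m}\<close> that] .
    show ?thesis unfolding row_mass_def by measurable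
  qed
  show sets: "spread_unitaries m n \<in> sets \<mu>"
    unfolding eq using meas by measurable
  have sub: "space \<mu> - spread_unitaries m n \<subseteq> (\<Union>i<m. B i 1 \<union> B i \<i>)"
  proof
    fix U assume U: "U \<in> space \<mu> - spread_unitaries m n"
    then obtain i where i: "i < m" "1 / (4 * real n) < row_mass n U i"
      unfolding eq by (auto simp: not_le)
    have "row_mass n U i = (\<Sum>j<n. (Re (1 * U $$ (i, j)))\<^sup>2) + (\<Sum>j<n. (Re (\<i> * U $$ (i, j)))\<^sup>2)"
      unfolding row_mass_def sum.distrib[symmetric] by (intro sum.cong refl) (simp add: cmod_power2)
    hence "U \<in> B i 1 \<union> B i \<i>"
      using i U unfolding B_def by auto
    thus "U \<in> (\<Union>i<m. B i 1 \<union> B i \<i>)" using i by blast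
  qed
  have Ble: "measure \<mu> (B i z) \<le> exp (3 * real n - real m / (32 * real n))" if "i < m" "cmod z = 1" for i z
    using haar_row_part_tail[OF haar that(1) n that(2), of "1 / (8 * real n)"] by (simp add: B_def)
  have "1 - measure \<mu> (spread_unitaries m n) = measure \<mu> (space \<mu> - spread_unitaries m n)"
    using prob_compl[OF sets] by simp
  also have "\<dots> \<le> measure \<mu> (\<Union>i<m. B i 1 \<union> B i \<i>)"
    using sub B by (intro finite_measure_mono) auto
  also have "\<dots> \<le> (\<Sum>i<m. measure \<mu> (B i 1 \<union> B i \<i>))"
    using B by (intro finite_measure_subadditive_finite) auto
  also have "\<dots> \<le> (\<Sum>i<m. 2 * exp (3 * real n - real m / (32 * real n)))"
  proof (rule sum_mono)
    fix i assume "i \<in> {..<m}"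
    hence i: "i < m" by simp
    have "measure \<mu> (B i 1 \<union> B i \<i>) \<le> measure \<mu> (B i 1) + measure \<mu> (B i \<i>)"
      by (intro measure_Un_le B[OF i])
    thus "measure \<mu> (B i 1 \<union> B i \<i>) \<le> 2 * exp (3 * real n - real m / (32 * real n))"
      using Ble[OF i, of 1] Ble[OF i, of \<i>] by simp
  qed
  finally show "measure \<mu> (spread_unitaries m n) \<ge> 1 - 2 * real m * exp (3 * real n - real m / (32 * real n))"
    by simp
qed

section \<open>Permanents of submatrices of a unitary matrix\<close>

text \<open>The permanent of the rows \<open>f 0, ..., f (n - 1)\<close>, repetitions allowed.
  Indexing by functions rather than occupation numbers lets sums over outcomes factorise over
  positions.\<close>

definition amplitude :: "nat \<Rightarrow> complex mat \<Rightarrow> (nat \<Rightarrow> nat) \<Rightarrow> complex" where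
  "amplitude n U f = (\<Sum>\<tau> | \<tau> permutes {..<n}. \<Prod>i<n. U $$ (f i, \<tau> i))"

lemma permanent_boson_submatrix:
  "permanent (boson_submatrix n U S) = amplitude n U (\<lambda>i. row_indices S ! i)"
proof -
  have "(\<Prod>j = 0..<n. boson_submatrix n U S $$ (j, \<tau> j)) = (\<Prod>i<n. U $$ (row_indices S ! i, \<tau> i))"
    if "\<tau> permutes {..<n}" for \<tau>
    using permutes_in_image[OF that]
    by (auto simp: boson_submatrix_def atLeast0LessThan intro!: prod.cong)
  moreover have "dim_row (boson_submatrix n U S) = n"
    by (simp add: boson_submatrix_def)
  ultimately show ?thesis
    by (simp add: permanent_def amplitude_def atLeast0LessThan)
qed

lemma amplitude_cong:
  assumes "\<And>i. i < n \<Longrightarrow> f i = g i"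
  shows "amplitude n U f = amplitude n U g"
  using assms by (simp add: amplitude_def)

text \<open>Reindexing first the permutations and then the factors by \<open>\<pi>\<close> absorbs
  it. Hence all orderings of one outcome share the same amplitude.\<close>

lemma amplitude_permute:
  assumes \<pi>: "\<pi> permutes {..<n}"
  shows "amplitude n U (f \<circ> \<pi>) = amplitude n U f"
proof -
  have "amplitude n U (f \<circ> \<pi>) = (\<Sum>\<tau> | \<tau> permutes {..<n}. \<Prod>i<n. U $$ (f (\<pi> i), (\<tau> \<circ> \<pi>) i))"
    unfolding amplitude_def
    by (subst sum_permutations_compose_right[OF \<pi>]) simp
  also have "\<dots> = amplitude n U f"
    unfolding amplitude_def
    by (subst (2) prod.permute[OF \<pi>]) (simp add: comp_def)
  finally show ?thesis .
qed

lemma amplitude_mset_cong: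
  assumes "mset xs = mset ys" "length ys = n"
  shows "amplitude n U (\<lambda>i. xs ! i) = amplitude n U (\<lambda>i. ys ! i)"
proof -
  obtain p where p: "p permutes {..<length ys}" "permute_list p ys = xs"
    using assms(1) by (rule mset_eq_permutation)
  have "amplitude n U (\<lambda>i. xs ! i) = amplitude n U ((\<lambda>i. ys ! i) \<circ> p)"
    using p assms by (intro amplitude_cong) (auto simp: permute_list_nth)
  also have "\<dots> = amplitude n U (\<lambda>i. ys ! i)"
    using p assms by (intro amplitude_permute) simp
  finally show ?thesis .
qed

text \<open>Enlarging the permutations to all maps of \<open>{..<n}\<close> into itself only adds
  nonnegative terms, and the sum over all maps is a product of row sums.\<close>

lemma amplitude_norm_le:
  "cmod (amplitude n U f) \<le> (\<Prod>i<n. \<Sum>j<n. cmod (U $$ (f i, j)))"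
proof -
  have "cmod (amplitude n U f) \<le> (\<Sum>\<tau> | \<tau> permutes {..<n}. \<Prod>i<n. cmod (U $$ (f i, \<tau> i)))"
    unfolding amplitude_def by (rule order_trans[OF norm_sum]) (simp add: prod_norm)
  \<comment> \<open>Permutations are the identity outside \<open>{..<n}\<close>, members of
    \<open>PiE\<close> are \<open>undefined\<close> there; restriction makes the inclusion
    literal.\<close>
  also have "\<dots> = (\<Sum>\<tau> | \<tau> permutes {..<n}. \<Prod>i<n. cmod (U $$ (f i, restrict \<tau> {..<n} i)))"
    by simp
  also have "\<dots> = (\<Sum>g\<in>(\<lambda>\<tau>. restrict \<tau> {..<n}) ` {\<tau>. \<tau> permutes {..<n}}. \<Prod>i<n. cmod (U $$ (f i, g i)))"
  proof (subst sum.reindex)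
    show "inj_on (\<lambda>\<tau>. restrict \<tau> {..<n}) {\<tau>. \<tau> permutes {..<n}}"
    proof (rule inj_onI, rule ext)
      fix \<sigma> \<tau> i
      assume *: "\<sigma> \<in> {\<tau>. \<tau> permutes {..<n}}" "\<tau> \<in> {\<tau>. \<tau> permutes {..<n}}"
        and eq: "restrict \<sigma> {..<n} = restrict \<tau> {..<n}"
      show "\<sigma> i = \<tau> i"
        using * fun_cong[OF eq, of i] by (cases "i < n") (auto simp: permutes_def)
    qed
  qed simp
  also have "\<dots> \<le> (\<Sum>g\<in>PiE {..<n} (\<lambda>_. {..<n}). \<Prod>i<n. cmod (U $$ (f i, g i)))"
  proof (rule sum_mono2)
    show "(\<lambda>\<tau>. restrict \<tau> {..<n}) ` {\<tau>. \<tau> permutes {..<n}} \<subseteq> PiE {..<n} (\<lambda>_. {..<n})"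
      using permutes_in_image by fastforce
  qed (auto intro: finite_PiE prod_nonneg)
  also have "\<dots> = (\<Prod>i<n. \<Sum>j<n. cmod (U $$ (f i, j)))"
    by (subst prod_sum_PiE) auto
  finally show ?thesis .
qed

section \<open>Second moments of amplitudes over ordered sequences\<close>

lemma amplitude_norm_square:
  "complex_of_real ((cmod (amplitude n U f))\<^sup>2) = (\<Sum>\<sigma> | \<sigma> permutes {..<n}. \<Sum>\<tau> | \<tau> permutes {..<n}.
     \<Prod>i<n. cnj (U $$ (f i, \<sigma> i)) * U $$ (f i, \<tau> i))"
proof -
  have "complex_of_real ((cmod (amplitude n U f))\<^sup>2) = cnj (amplitude n U f) * amplitude n U f"
    by (simp only: complex_norm_square mult.commute)
  thus ?thesis
    by (simp only: amplitude_def cnj_sum cnj_prod sum_product prod.distrib)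
qed

text \<open>The expanded square is a sum of products over positions, so summing over a box
  factorises. The sets \<open>B i\<close> may differ so that single positions can be pinned to one
  row.\<close>

lemma sum_amplitude_norm_square_PiE:
  assumes "\<And>i. i < n \<Longrightarrow> finite (B i)"
  shows "complex_of_real (\<Sum>f\<in>PiE {..<n} B. (cmod (amplitude n U f))\<^sup>2) =
    (\<Sum>\<sigma> | \<sigma> permutes {..<n}. \<Sum>\<tau> | \<tau> permutes {..<n}.
       \<Prod>i<n. \<Sum>y\<in>B i. cnj (U $$ (y, \<sigma> i)) * U $$ (y, \<tau> i))"
proof -
  have "complex_of_real (\<Sum>f\<in>PiE {..<n} B. (cmod (amplitude n U f))\<^sup>2)
      = (\<Sum>f\<in>PiE {..<n} B. \<Sum>\<sigma> | \<sigma> permutes {..<n}. \<Sum>\<tau> | \<tau> permutes {..<n}.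
     \<Prod>i<n. cnj (U $$ (f i, \<sigma> i)) * U $$ (f i, \<tau> i))"
    by (simp only: of_real_sum amplitude_norm_square)
  also have "\<dots> = (\<Sum>\<sigma> | \<sigma> permutes {..<n}. \<Sum>\<tau> | \<tau> permutes {..<n}. \<Sum>f\<in>PiE {..<n} B.
     \<Prod>i<n. cnj (U $$ (f i, \<sigma> i)) * U $$ (f i, \<tau> i))"
    by (subst sum.swap, rule sum.cong[OF refl], rule sum.swap)
  also have "\<dots> = (\<Sum>\<sigma> | \<sigma> permutes {..<n}. \<Sum>\<tau> | \<tau> permutes {..<n}.
       \<Prod>i<n. \<Sum>y\<in>B i. cnj (U $$ (y, \<sigma> i)) * U $$ (y, \<tau> i))"
    using assms by (intro sum.cong refl prod_sum_PiE[symmetric]) auto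
  finally show ?thesis .
qed

text \<open>Every factor is an inner product of two columns, so only
  \<open>\<sigma> = \<tau>\<close> survives and each permutation contributes 1. Divided by
  \<open>fact n\<close>, this is the normalisation of the distribution.\<close>

lemma sum_amplitude_norm_square:
  assumes U: "U \<in> unitary_group m" and n: "n \<le> m"
  shows "(\<Sum>f\<in>PiE {..<n} (\<lambda>_. {..<m}). (cmod (amplitude n U f))\<^sup>2) = fact n"
proof -
  have "(\<Prod>i<n. \<Sum>y<m. cnj (U $$ (y, \<sigma> i)) * U $$ (y, \<tau> i)) = (if \<tau> = \<sigma> then 1 else 0)"
    if "\<sigma> permutes {..<n}" "\<tau> permutes {..<n}" for \<sigma> \<tau>
  proof -
    have "(\<Prod>i<n. \<Sum>y<m. cnj (U $$ (y, \<sigma> i)) * U $$ (y, \<tau> i)) = (\<Prod>i<n. if \<sigma> i = \<tau> i then 1 else 0)"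
    proof (intro prod.cong refl)
      fix i assume "i \<in> {..<n}"
      hence "\<sigma> i < m" "\<tau> i < m"
        using permutes_in_image[OF that(1), of i] permutes_in_image[OF that(2), of i] n by auto
      thus "(\<Sum>y<m. cnj (U $$ (y, \<sigma> i)) * U $$ (y, \<tau> i)) = (if \<sigma> i = \<tau> i then 1 else 0)"
        using U by (simp add: unitary_group_iff)
    qed
    also have "\<dots> = (if \<tau> = \<sigma> then 1 else 0)"
    proof (cases "\<tau> = \<sigma>")
      case False
      then obtain i where "\<tau> i \<noteq> \<sigma> i" by auto
      moreover from this have "i < n" using that by (metis lessThan_iff permutes_not_in)
      ultimately show ?thesis using False by (auto intro!: bexI[of _ i])
    qed simp
    finally show ?thesis .
  qed
  hence "complex_of_real (\<Sum>f\<in>PiE {..<n} (\<lambda>_. {..<m}). (cmod (amplitude n U f))\<^sup>2)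
      = (\<Sum>\<sigma> | \<sigma> permutes {..<n}. \<Sum>\<tau> | \<tau> permutes {..<n}. if \<tau> = \<sigma> then 1 else 0)"
    by (subst sum_amplitude_norm_square_PiE) (auto intro!: sum.cong)
  also have "\<dots> = complex_of_real (fact n)"
    by (simp add: finite_permutations card_permutations[OF card_lessThan])
  finally show ?thesis
    by (simp only: of_real_eq_iff)
qed

text \<open>The inverse of \<open>\<sigma>\<close> after \<open>\<tau>\<close> fixes all points off
  \<open>{p, q}\<close>, hence is the identity or the transposition.\<close>

lemma permutes_agree_except_two:
  assumes \<sigma>: "\<sigma> permutes {..<n}" and \<tau>: "\<tau> permutes {..<n}"
    and agree: "\<And>i. i < n \<Longrightarrow> i \<noteq> p \<Longrightarrow> i \<noteq> q \<Longrightarrow> \<sigma> i = \<tau> i"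
  shows "\<tau> = \<sigma> \<or> \<tau> = \<sigma> \<circ> Transposition.transpose p q"
proof -
  define \<pi> where "\<pi> = inv_into UNIV \<sigma> \<circ> \<tau>"
  have \<pi>: "\<pi> permutes {..<n}"
    unfolding \<pi>_def using \<tau> permutes_inv[OF \<sigma>] by (rule permutes_compose)
  have "\<pi> permutes {p, q}"
  proof (rule permutes_superset[OF \<pi>])
    fix i assume "i \<in> {..<n} - {p, q}"
    hence "\<tau> i = \<sigma> i" using agree by auto
    thus "\<pi> i = i" using permutes_inverses(2)[OF \<sigma>] by (simp add: \<pi>_def)
  qed
  moreover have "\<tau> = \<sigma> \<circ> \<pi>"
    using permutes_inverses(1)[OF \<sigma>] by (auto simp: \<pi>_def fun_eq_iff)
  ultimately show ?thesis
    by (auto simp: permutes_doubleton_iff)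
qed

text \<open>
  By column orthogonality only pairs \<open>\<sigma>, \<tau>\<close> that agree off \<open>{p, q}\<close> survive in the expanded square.
\<close>

lemma sum_amplitude_coincidence_le:
  assumes U: "U \<in> unitary_group m" and n: "n \<le> m" and pq: "p < n" "q < n" "p \<noteq> q"
  shows "(\<Sum>f | f \<in> PiE {..<n} (\<lambda>_. {..<m}) \<and> f p = f q. (cmod (amplitude n U f))\<^sup>2)
     \<le> (\<Sum>j<m. \<Sum>\<sigma> | \<sigma> permutes {..<n}. 2 * ((cmod (U $$ (j, \<sigma> p)))\<^sup>2 * (cmod (U $$ (j, \<sigma> q)))\<^sup>2))"
proof -
  \<comment> \<open>\<open>B j\<close> pins positions \<open>p\<close> and \<open>q\<close> to row
    \<open>j\<close> and leaves the others free. The sequences with \<open>f p = f q\<close> are the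
    disjoint union of these boxes.\<close>
  define B where "B j i = (if i = p \<or> i = q then {j} else {..<m})" for j i :: nat
  let ?P = "{\<sigma>. \<sigma> permutes {..<n}}"
  let ?T = "\<lambda>j \<sigma> \<tau>. \<Prod>i<n. \<Sum>y\<in>B j i. cnj (U $$ (y, \<sigma> i)) * U $$ (y, \<tau> i)"
  let ?u = "\<lambda>j a. cmod (U $$ (j, a))"
  have finP: "finite ?P" by (intro finite_permutations) auto
  have finB: "finite (B j i)" for j i by (simp add: B_def)
  have remove2: "(\<Prod>i<n. g i) = g p * (g q * (\<Prod>i\<in>{..<n} - {p} - {q}. g i))" for g :: "nat \<Rightarrow> complex"
    using prod.remove[of "{..<n}" p g] prod.remove[of "{..<n} - {p}" q g] pq by simp
  have T_bound: "(\<Sum>\<tau>\<in>?P. cmod (?T j \<sigma> \<tau>)) \<le> 2 * ((?u j (\<sigma> p))\<^sup>2 * (?u j (\<sigma> q))\<^sup>2)"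
    if \<sigma>: "\<sigma> permutes {..<n}" for j \<sigma>
  proof -
    let ?c = "(?u j (\<sigma> p))\<^sup>2 * (?u j (\<sigma> q))\<^sup>2"
    let ?D = "{\<sigma>, \<sigma> \<circ> Transposition.transpose p q}"
    have T_eq: "?T j \<sigma> \<tau> = (cnj (U $$ (j, \<sigma> p)) * U $$ (j, \<tau> p)) * ((cnj (U $$ (j, \<sigma> q)) * U $$ (j, \<tau> q))
        * (\<Prod>i\<in>{..<n} - {p} - {q}. if \<sigma> i = \<tau> i then 1 else 0))" if \<tau>: "\<tau> permutes {..<n}" for \<tau>
    proof -
      have "(\<Sum>y\<in>B j i. cnj (U $$ (y, \<sigma> i)) * U $$ (y, \<tau> i)) = (if \<sigma> i = \<tau> i then 1 else 0)"
        if i: "i \<in> {..<n} - {p} - {q}" for i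
      proof -
        have "\<sigma> i < m" "\<tau> i < m"
          using i permutes_in_image[OF \<sigma>, of i] permutes_in_image[OF \<tau>, of i] n by auto
        thus ?thesis
          using U i by (simp add: unitary_group_iff B_def)
      qed
      hence "(\<Prod>i\<in>{..<n} - {p} - {q}. \<Sum>y\<in>B j i. cnj (U $$ (y, \<sigma> i)) * U $$ (y, \<tau> i))
          = (\<Prod>i\<in>{..<n} - {p} - {q}. if \<sigma> i = \<tau> i then 1 else 0)"
        by (rule prod.cong[OF refl])
      moreover have "?T j \<sigma> \<tau> = (\<Sum>y\<in>B j p. cnj (U $$ (y, \<sigma> p)) * U $$ (y, \<tau> p))
          * ((\<Sum>y\<in>B j q. cnj (U $$ (y, \<sigma> q)) * U $$ (y, \<tau> q))
          * (\<Prod>i\<in>{..<n} - {p} - {q}. \<Sum>y\<in>B j i. cnj (U $$ (y, \<sigma> i)) * U $$ (y, \<tau> i)))"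
        by (rule remove2)
      ultimately show ?thesis
        by (simp add: B_def)
    qed
    have zero: "?T j \<sigma> \<tau> = 0" if \<tau>: "\<tau> permutes {..<n}" and "\<tau> \<notin> ?D" for \<tau>
    proof -
      obtain i where "i < n" "i \<noteq> p" "i \<noteq> q" "\<sigma> i \<noteq> \<tau> i"
        using permutes_agree_except_two[OF \<sigma> \<tau>, of p q] \<open>\<tau> \<notin> ?D\<close> by auto
      hence "(\<Prod>i\<in>{..<n} - {p} - {q}. if \<sigma> i = \<tau> i then 1 else (0::complex)) = 0"
        by (intro prod_zero) auto
      thus ?thesis unfolding T_eq[OF \<tau>] by simp
    qed
    have le: "cmod (?T j \<sigma> \<tau>) \<le> ?c" if \<tau>: "\<tau> permutes {..<n}" and D: "\<tau> \<in> ?D" for \<tau>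
    proof -
      \<comment> \<open>Both surviving \<open>\<tau>\<close> use the same two entries of row
        \<open>j\<close>, possibly swapped, so each contributes at most \<open>?c\<close>; counting
        them gives the factor 2.\<close>
      have "(\<tau> p = \<sigma> p \<and> \<tau> q = \<sigma> q) \<or> (\<tau> p = \<sigma> q \<and> \<tau> q = \<sigma> p)"
        using D by auto
      hence "?u j (\<sigma> p) * ?u j (\<tau> p) * (?u j (\<sigma> q) * ?u j (\<tau> q)) = ?c"
        by (auto simp: power2_eq_square mult_ac)
      moreover have "cmod (?T j \<sigma> \<tau>) = ?u j (\<sigma> p) * ?u j (\<tau> p) * (?u j (\<sigma> q) * ?u j (\<tau> q))
          * cmod (\<Prod>i\<in>{..<n} - {p} - {q}. if \<sigma> i = \<tau> i then 1 else 0)"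
        unfolding T_eq[OF \<tau>] by (simp only: norm_mult complex_mod_cnj mult_ac)
      ultimately have "cmod (?T j \<sigma> \<tau>)
          = ?c * cmod (\<Prod>i\<in>{..<n} - {p} - {q}. if \<sigma> i = \<tau> i then 1 else 0)"
        by (simp only:)
      also have "\<dots> \<le> ?c * 1"
        unfolding prod_norm[symmetric] by (intro mult_left_mono prod_le_1) auto
      finally show ?thesis by (simp only: mult_1_right)
    qed
    have "(\<Sum>\<tau>\<in>?P. cmod (?T j \<sigma> \<tau>)) \<le> (\<Sum>\<tau>\<in>?P. if \<tau> \<in> ?D then ?c else 0)"
    proof (rule sum_mono)
      fix \<tau> assume "\<tau> \<in> ?P"
      hence \<tau>: "\<tau> permutes {..<n}" by simp
      show "cmod (?T j \<sigma> \<tau>) \<le> (if \<tau> \<in> ?D then ?c else 0)"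
      proof (cases "\<tau> \<in> ?D")
        case True
        show ?thesis unfolding if_P[OF True] by (rule le[OF \<tau> True])
      next
        case False
        show ?thesis unfolding if_not_P[OF False] zero[OF \<tau> False] by simp
      qed
    qed
    also have "\<dots> = real (card (?P \<inter> ?D)) * ?c"
      using finP by (simp only: sum.inter_restrict[symmetric] sum_constant)
    also have "\<dots> \<le> real 2 * ?c"
    proof (intro mult_right_mono of_nat_mono)
      have "card (?P \<inter> ?D) \<le> card ?D" by (intro card_mono) auto
      also have "\<dots> \<le> 2" by (rule card_insert_le_m1) auto
      finally show "card (?P \<inter> ?D) \<le> 2" .
    qed simp
    finally show ?thesis by simp
  qed
  have split: "{f. f \<in> PiE {..<n} (\<lambda>_. {..<m}) \<and> f p = f q} = (\<Union>j<m. PiE {..<n} (B j))"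
  proof (intro equalityI subsetI)
    fix f assume f: "f \<in> {f. f \<in> PiE {..<n} (\<lambda>_. {..<m}) \<and> f p = f q}"
    hence "f \<in> PiE {..<n} (B (f p))" "f p < m"
      using pq by (auto simp: B_def PiE_def Pi_def split: if_splits)
    thus "f \<in> (\<Union>j<m. PiE {..<n} (B j))" by blast
  next
    fix f assume "f \<in> (\<Union>j<m. PiE {..<n} (B j))"
    then obtain j where j: "j < m" "f \<in> PiE {..<n} (B j)" by blast
    have "f i \<in> B j i" if "i < n" for i using j that by (auto simp: PiE_def Pi_def)
    hence "f i < m" if "i < n" for i using j that by (fastforce simp: B_def split: if_splits)
    moreover have "f p = j" "f q = j"
      using PiE_mem[OF j(2), of p] PiE_mem[OF j(2), of q] pq by (auto simp: B_def)
    ultimately show "f \<in> {f. f \<in> PiE {..<n} (\<lambda>_. {..<m}) \<and> f p = f q}"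
      using j by (auto simp: PiE_def Pi_def)
  qed
  have disj: "PiE {..<n} (B j) \<inter> PiE {..<n} (B k) = {}" if "j \<noteq> k" for j k
  proof (rule ccontr)
    assume "PiE {..<n} (B j) \<inter> PiE {..<n} (B k) \<noteq> {}"
    then obtain f where "f \<in> PiE {..<n} (B j)" "f \<in> PiE {..<n} (B k)" by blast
    hence "f p \<in> B j p" "f p \<in> B k p" using pq by (auto simp: PiE_def Pi_def)
    thus False using that by (simp add: B_def)
  qed
  have "(\<Sum>f | f \<in> PiE {..<n} (\<lambda>_. {..<m}) \<and> f p = f q. (cmod (amplitude n U f))\<^sup>2)
      = (\<Sum>j<m. \<Sum>f\<in>PiE {..<n} (B j). (cmod (amplitude n U f))\<^sup>2)"
    unfolding split
  proof (rule sum.UNION_disjoint)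
    show "\<forall>j\<in>{..<m}. finite (PiE {..<n} (B j))"
      using finB by (auto intro: finite_PiE)
    show "\<forall>j\<in>{..<m}. \<forall>k\<in>{..<m}. j \<noteq> k \<longrightarrow> PiE {..<n} (B j) \<inter> PiE {..<n} (B k) = {}"
      by (intro ballI impI disj)
  qed simp
  also have "\<dots> \<le> (\<Sum>j<m. \<Sum>\<sigma>\<in>?P. 2 * ((?u j (\<sigma> p))\<^sup>2 * (?u j (\<sigma> q))\<^sup>2))"
  proof (rule sum_mono)
    fix j
    have "(\<Sum>f\<in>PiE {..<n} (B j). (cmod (amplitude n U f))\<^sup>2)
        \<le> cmod (complex_of_real (\<Sum>f\<in>PiE {..<n} (B j). (cmod (amplitude n U f))\<^sup>2))"
      unfolding norm_of_real by (rule abs_ge_self)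
    also have "\<dots> = cmod (\<Sum>\<sigma>\<in>?P. \<Sum>\<tau>\<in>?P. ?T j \<sigma> \<tau>)"
      using finB by (subst sum_amplitude_norm_square_PiE) auto
    also have "\<dots> \<le> (\<Sum>\<sigma>\<in>?P. \<Sum>\<tau>\<in>?P. cmod (?T j \<sigma> \<tau>))"
      by (rule order_trans[OF norm_sum sum_mono[OF norm_sum]])
    also have "\<dots> \<le> (\<Sum>\<sigma>\<in>?P. 2 * ((?u j (\<sigma> p))\<^sup>2 * (?u j (\<sigma> q))\<^sup>2))"
      using T_bound by (intro sum_mono) auto
    finally show "(\<Sum>f\<in>PiE {..<n} (B j). (cmod (amplitude n U f))\<^sup>2) \<le> \<dots>" .
  qed
  finally show ?thesis .
qed

lemma sum_UN_le:
  fixes f :: "'a \<Rightarrow> real"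
  assumes "finite I" "\<And>i. i \<in> I \<Longrightarrow> finite (A i)" "\<And>x. 0 \<le> f x"
  shows "sum f (\<Union>i\<in>I. A i) \<le> (\<Sum>i\<in>I. sum f (A i))"
  using assms(1,2)
proof (induction I rule: finite_induct)
  case (insert i I)
  have "sum f (\<Union>j\<in>insert i I. A j) = sum f (A i) + sum f (\<Union>j\<in>I. A j) - sum f (A i \<inter> (\<Union>j\<in>I. A j))"
    using insert by (simp add: sum_Un)
  also have "\<dots> \<le> sum f (A i) + sum f (\<Union>j\<in>I. A j)"
    using assms(3) by (simp add: sum_nonneg)
  also have "\<dots> \<le> (\<Sum>j\<in>insert i I. sum f (A j))"
    using insert by simp
  finally show ?case .
qed simp

text \<open>A union bound over the pairs of positions that may coincide. For fixed \<open>j\<close>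
  and \<open>\<sigma>\<close> the pair sums combine to the squared row mass, which does not depend
  on \<open>\<sigma>\<close>; the permutations then supply \<open>fact n\<close>.\<close>

lemma sum_amplitude_not_inj_le:
  assumes U: "U \<in> unitary_group m" and n: "n \<le> m"
  shows "(\<Sum>f | f \<in> PiE {..<n} (\<lambda>_. {..<m}) \<and> \<not> inj_on f {..<n}. (cmod (amplitude n U f))\<^sup>2)
     \<le> fact n * (2 * (\<Sum>j<m. (row_mass n U j)\<^sup>2))"
proof -
  let ?P = "{\<sigma>. \<sigma> permutes {..<n}}"
  let ?N = "{f. f \<in> PiE {..<n} (\<lambda>_. {..<m}) \<and> \<not> inj_on f {..<n}}"
  let ?C = "\<lambda>(p, q). {f. f \<in> PiE {..<n} (\<lambda>_. {..<m}) \<and> f p = f q}"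
  let ?I = "{(p, q). p < n \<and> q < n \<and> p \<noteq> q}"
  let ?u = "\<lambda>j a. (cmod (U $$ (j, a)))\<^sup>2"
  let ?a = "\<lambda>f. (cmod (amplitude n U f))\<^sup>2"
  have I: "?I \<subseteq> {..<n} \<times> {..<n}" by auto
  have finI: "finite ?I" by (rule finite_subset[OF I]) auto
  have finX: "finite (PiE {..<n} (\<lambda>_. {..<m}))" by (intro finite_PiE) auto
  have finC: "finite (?C pq)" for pq
    by (rule finite_subset[OF _ finX]) (auto split: prod.splits)
  have "?N \<subseteq> (\<Union>pq\<in>?I. ?C pq)"
    by (auto simp: inj_on_def)
  hence "sum ?a ?N \<le> sum ?a (\<Union>pq\<in>?I. ?C pq)"
    using finI finC by (intro sum_mono2) auto
  also have "\<dots> \<le> (\<Sum>pq\<in>?I. sum ?a (?C pq))"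
    using finI finC by (intro sum_UN_le) auto
  also have "\<dots> \<le> (\<Sum>(p, q)\<in>?I. \<Sum>j<m. \<Sum>\<sigma>\<in>?P. 2 * (?u j (\<sigma> p) * ?u j (\<sigma> q)))"
    using sum_amplitude_coincidence_le[OF U n] by (intro sum_mono) auto
  \<comment> \<open>The diagonal \<open>p = q\<close> is added to complete the square.\<close>
  also have "\<dots> \<le> (\<Sum>(p, q)\<in>{..<n} \<times> {..<n}. \<Sum>j<m. \<Sum>\<sigma>\<in>?P. 2 * (?u j (\<sigma> p) * ?u j (\<sigma> q)))"
    using I by (intro sum_mono2) (auto intro!: sum_nonneg)
  also have "\<dots> = (\<Sum>p<n. \<Sum>q<n. \<Sum>j<m. \<Sum>\<sigma>\<in>?P. 2 * (?u j (\<sigma> p) * ?u j (\<sigma> q)))"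
    by (rule sum.cartesian_product[symmetric])
  also have "\<dots> = (\<Sum>j<m. \<Sum>\<sigma>\<in>?P. \<Sum>p<n. \<Sum>q<n. 2 * (?u j (\<sigma> p) * ?u j (\<sigma> q)))"
  proof -
    have "(\<Sum>p<n. \<Sum>q<n. \<Sum>j<m. \<Sum>\<sigma>\<in>?P. 2 * (?u j (\<sigma> p) * ?u j (\<sigma> q)))
        = (\<Sum>p<n. \<Sum>j<m. \<Sum>q<n. \<Sum>\<sigma>\<in>?P. 2 * (?u j (\<sigma> p) * ?u j (\<sigma> q)))"
      by (rule sum.cong[OF refl], rule sum.swap)
    also have "\<dots> = (\<Sum>j<m. \<Sum>p<n. \<Sum>\<sigma>\<in>?P. \<Sum>q<n. 2 * (?u j (\<sigma> p) * ?u j (\<sigma> q)))"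
      by (subst sum.swap, rule sum.cong[OF refl], rule sum.cong[OF refl], rule sum.swap)
    also have "\<dots> = (\<Sum>j<m. \<Sum>\<sigma>\<in>?P. \<Sum>p<n. \<Sum>q<n. 2 * (?u j (\<sigma> p) * ?u j (\<sigma> q)))"
      by (rule sum.cong[OF refl], rule sum.swap)
    finally show ?thesis .
  qed
  also have "\<dots> = (\<Sum>j<m. \<Sum>\<sigma>\<in>?P. 2 * (\<Sum>p<n. ?u j (\<sigma> p))\<^sup>2)"
  proof -
    have sq: "(\<Sum>p<n. \<Sum>q<n. 2 * (g p * g q)) = 2 * (\<Sum>p<n. g p)\<^sup>2" for g :: "nat \<Rightarrow> real"
    proof -
      have "(\<Sum>p<n. g p)\<^sup>2 = (\<Sum>p<n. \<Sum>q<n. g p * g q)"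
        by (simp only: power2_eq_square sum_product)
      thus ?thesis by (simp only: sum_distrib_left)
    qed
    show ?thesis by (simp only: sq)
  qed
  also have "\<dots> = (\<Sum>j<m. \<Sum>\<sigma>\<in>?P. 2 * (row_mass n U j)\<^sup>2)"
  proof (intro sum.cong refl)
    fix j \<sigma> assume "\<sigma> \<in> ?P"
    hence "(\<Sum>p<n. ?u j (\<sigma> p)) = row_mass n U j"
      unfolding row_mass_def using sum.permute[of \<sigma> "{..<n}" "?u j"] by (simp add: comp_def)
    thus "2 * (\<Sum>p<n. ?u j (\<sigma> p))\<^sup>2 = 2 * (row_mass n U j)\<^sup>2" by simp
  qed
  also have "\<dots> = fact n * (2 * (\<Sum>j<m. (row_mass n U j)\<^sup>2))"
    by (simp add: card_permutations[OF card_lessThan] sum_distrib_left mult_ac)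
  finally show ?thesis .
qed

section \<open>Ordered sequences and occupation numbers\<close>

lemma sum_lists_length_eq:
  fixes G :: "nat list \<Rightarrow> 'b :: comm_monoid_add"
  shows "(\<Sum>xs | set xs \<subseteq> {..<m} \<and> length xs = n \<and> P xs. G xs)
       = (\<Sum>f | f \<in> PiE {..<n} (\<lambda>_. {..<m}) \<and> P (map f [0..<n]). G (map f [0..<n]))"
proof (rule sum.reindex_bij_witness[symmetric])
  fix xs assume xs: "xs \<in> {xs. set xs \<subseteq> {..<m} \<and> length xs = n \<and> P xs}"
  let ?f = "restrict ((!) xs) {..<n}"
  show eq: "map ?f [0..<n] = xs"
    using xs by (auto intro: nth_equalityI)
  show "?f \<in> {f. f \<in> PiE {..<n} (\<lambda>_. {..<m}) \<and> P (map f [0..<n])}"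
    using xs unfolding mem_Collect_eq eq by (auto simp: subset_iff)
next
  fix f assume f: "f \<in> {f. f \<in> PiE {..<n} (\<lambda>_. {..<m}) \<and> P (map f [0..<n])}"
  show "restrict ((!) (map f [0..<n])) {..<n} = f"
    using f by (auto simp: fun_eq_iff restrict_def PiE_def extensional_def)
  show "map f [0..<n] \<in> {xs. set xs \<subseteq> {..<m} \<and> length xs = n \<and> P xs}"
    using f by (auto simp: PiE_def Pi_def)
qed auto

lemma amplitude_map: "amplitude n U (\<lambda>i. map f [0..<n] ! i) = amplitude n U f"
  by (rule amplitude_cong) simp

definition occupation :: "nat \<Rightarrow> nat list \<Rightarrow> nat list" where
  "occupation m xs = map (count (mset xs)) [0..<m]"

lemma count_row_indices:
  "count (mset (row_indices S)) k = (if k < length S then S ! k else 0)"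
proof -
  have "count (mset (concat (map (\<lambda>j. replicate (S ! j) j) [0..<l]))) k = (if k < l then S ! k else 0)" for l
    by (induction l) (auto simp: less_Suc_eq)
  thus ?thesis by (simp add: row_indices_def)
qed

lemma set_row_indices: "set (row_indices S) \<subseteq> {..<length S}"
  by (auto simp: row_indices_def)

lemma length_row_indices: "length (row_indices S) = sum_list S"
proof -
  have "length (row_indices S) = sum_list (map ((!) S) [0..<length S])"
    by (simp add: row_indices_def length_concat comp_def)
  thus ?thesis by (simp add: map_nth)
qed

text \<open>Occupation numbers determine a mode sequence up to order, so a fiber of
  \<open>occupation m\<close> consists of the arrangements of one multiset and can be
  counted.\<close>

lemma occupation_eq_iff:
  assumes "S \<in> sample_space m n"
  shows "set xs \<subseteq> {..<m} \<and> length xs = n \<and> occupation m xs = S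
     \<longleftrightarrow> xs \<in> permutations_of_multiset (mset (row_indices S))"
proof
  have len: "length S = m" "sum_list S = n"
    using assms by (auto simp: sample_space_def)
  {
    assume xs: "set xs \<subseteq> {..<m} \<and> length xs = n \<and> occupation m xs = S"
    have "mset xs = mset (row_indices S)"
    proof (rule multiset_eqI)
      fix k
      show "count (mset xs) k = count (mset (row_indices S)) k"
      proof (cases "k < m")
        case True
        hence "S ! k = count (mset xs) k" using xs by (auto simp: occupation_def)
        thus ?thesis using True len by (simp add: count_row_indices)
      next
        case False
        hence "k \<notin> set xs" using xs by auto
        thus ?thesis using False len by (simp add: count_row_indices count_eq_zero_iff)
      qed
    qed
    thus "xs \<in> permutations_of_multiset (mset (row_indices S))"
      by (simp add: permutations_of_multiset_def)
  }
  {
    assume "xs \<in> permutations_of_multiset (mset (row_indices S))"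
    hence ms: "mset xs = mset (row_indices S)" by (simp add: permutations_of_multiset_def)
    have "set xs \<subseteq> {..<m}"
      using mset_eq_setD[OF ms] set_row_indices[of S] len by simp
    moreover have "length xs = n"
      using mset_eq_length[OF ms] length_row_indices[of S] len by simp
    moreover have "occupation m xs = S"
      unfolding occupation_def ms using len by (intro nth_equalityI) (auto simp: count_row_indices)
    ultimately show "set xs \<subseteq> {..<m} \<and> length xs = n \<and> occupation m xs = S" by blast
  }
qed

lemma sum_list_occupation:
  assumes "set xs \<subseteq> {..<m}"
  shows "sum_list (occupation m xs) = length xs"
proof -
  have "sum_list (occupation m xs) = (\<Sum>k<m. count (mset xs) k)"
    by (simp add: occupation_def interv_sum_list_conv_sum_set_nat atLeast0LessThan)
  also have "\<dots> = (\<Sum>k\<in>set xs. count (mset xs) k)"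
    using assms by (intro sum.mono_neutral_right) (auto simp: count_eq_zero_iff)
  also have "\<dots> = length xs"
    by (metis size_mset size_multiset_overloaded_eq set_mset_mset)
  finally show ?thesis .
qed

lemma finite_sample_space: "finite (sample_space m n)"
proof (rule finite_subset)
  show "sample_space m n \<subseteq> {xs. set xs \<subseteq> {..n} \<and> length xs = m}"
    by (auto simp: sample_space_def member_le_sum_list)
qed (rule finite_lists_length_eq, simp)

text \<open>The multinomial coefficient with its denominator multiplied out. Empty modes contribute
  \<open>fact 0 = 1\<close>, so the product may run over all \<open>m\<close> modes.\<close>

lemma card_arrangements:
  assumes "S \<in> sample_space m n"
  shows "card (permutations_of_multiset (mset (row_indices S))) * (\<Prod>j<m. fact (S ! j)) = fact n"
proof -
  let ?A = "mset (row_indices S)"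
  have len: "length S = m" "sum_list S = n"
    using assms by (auto simp: sample_space_def)
  have count_0: "count ?A j = 0" if "j \<notin> set (row_indices S)" for j
    using that by (simp add: count_eq_zero_iff)
  have "(\<Prod>x\<in>set_mset ?A. fact (count ?A x)) = (\<Prod>j<m. fact (count ?A j) :: nat)"
    using set_row_indices[of S] len by (intro prod.mono_neutral_left) (auto simp: count_0)
  also have "\<dots> = (\<Prod>j<m. fact (S ! j))"
    using len by (simp add: count_row_indices)
  finally show ?thesis
    using card_permutations_of_multiset[of ?A] len by (simp add: length_row_indices)
qed

section \<open>The Boson-Sampling distribution\<close>

definition boson_weight :: "nat \<Rightarrow> complex mat \<Rightarrow> nat list \<Rightarrow> real" where
  "boson_weight n U S = (cmod (permanent (boson_submatrix n U S)))\<^sup>2 / (\<Prod>j<length S. fact (S ! j))"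

text \<open>There are \<open>n! / (s_1! ... s_m!)\<close> orderings of \<open>S\<close>, all with
  the same amplitude. The factorials in the weight are thus exactly what makes it a sum over ordered
  sequences divided by \<open>n!\<close>.\<close>

lemma boson_weight_eq:
  assumes S: "S \<in> sample_space m n"
  shows "fact n * boson_weight n U S = (\<Sum>xs | set xs \<subseteq> {..<m} \<and> length xs = n \<and> occupation m xs = S.
    (cmod (amplitude n U (\<lambda>i. xs ! i)))\<^sup>2)"
proof -
  let ?T = "permutations_of_multiset (mset (row_indices S))"
  let ?a = "(cmod (amplitude n U (\<lambda>i. row_indices S ! i)))\<^sup>2"
  let ?F = "(\<Prod>j<m. fact (S ! j)) :: nat"
  have len: "length S = m" "length (row_indices S) = n"
    using S by (auto simp: sample_space_def length_row_indices)
  have "(\<Sum>xs\<in>?T. (cmod (amplitude n U (\<lambda>i. xs ! i)))\<^sup>2) = (\<Sum>xs\<in>?T. ?a)"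
  proof (intro sum.cong refl)
    fix xs assume "xs \<in> ?T"
    hence "mset xs = mset (row_indices S)" by (simp add: permutations_of_multiset_def)
    from amplitude_mset_cong[OF this len(2), of U]
    show "(cmod (amplitude n U (\<lambda>i. xs ! i)))\<^sup>2 = ?a" by (simp only:)
  qed
  also have "\<dots> = real (card ?T) * ?a"
    by simp
  also have "\<dots> = real (card ?T * ?F) * boson_weight n U S"
    by (simp add: boson_weight_def permanent_boson_submatrix len)
  also have "\<dots> = fact n * boson_weight n U S"
    unfolding card_arrangements[OF S] by simp
  finally show ?thesis
    unfolding occupation_eq_iff[OF S] by simp
qed

lemma sum_boson_weight:
  assumes A: "A \<subseteq> sample_space m n"
  shows "fact n * (\<Sum>S\<in>A. boson_weight n U S)
    = (\<Sum>xs | set xs \<subseteq> {..<m} \<and> length xs = n \<and> occupation m xs \<in> A.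
        (cmod (amplitude n U (\<lambda>i. xs ! i)))\<^sup>2)"
proof -
  let ?X = "{xs. set xs \<subseteq> {..<m} \<and> length xs = n \<and> occupation m xs \<in> A}"
  have finX: "finite ?X"
    by (rule finite_subset[of _ "{xs. set xs \<subseteq> {..<m} \<and> length xs = n}"])
      (auto intro: finite_lists_length_eq)
  have finA: "finite A" using A finite_sample_space by (rule finite_subset)
  have "fact n * (\<Sum>S\<in>A. boson_weight n U S) = (\<Sum>S\<in>A. \<Sum>xs | xs \<in> ?X \<and> occupation m xs = S.
    (cmod (amplitude n U (\<lambda>i. xs ! i)))\<^sup>2)"
    unfolding sum_distrib_left
  proof (intro sum.cong refl)
    fix S assume S: "S \<in> A"
    have "{xs. xs \<in> ?X \<and> occupation m xs = S}
        = {xs. set xs \<subseteq> {..<m} \<and> length xs = n \<and> occupation m xs = S}"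
      using S by auto
    thus "fact n * boson_weight n U S = (\<Sum>xs | xs \<in> ?X \<and> occupation m xs = S.
      (cmod (amplitude n U (\<lambda>i. xs ! i)))\<^sup>2)"
      using boson_weight_eq[of S m n U] S A by auto
  qed
  also have "\<dots> = (\<Sum>xs\<in>?X. (cmod (amplitude n U (\<lambda>i. xs ! i)))\<^sup>2)"
    by (rule sum.group[OF finX finA]) auto
  finally show ?thesis .
qed

lemma sum_boson_weight_sample_space:
  assumes "U \<in> unitary_group m" "n \<le> m"
  shows "(\<Sum>S\<in>sample_space m n. boson_weight n U S) = 1"
proof -
  \<comment> \<open>The conjunct \<open>True\<close> gives the index set the shape rewritten by
    \<open>sum_lists_length_eq\<close>.\<close>
  have "fact n * (\<Sum>S\<in>sample_space m n. boson_weight n U S)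
      = (\<Sum>xs | set xs \<subseteq> {..<m} \<and> length xs = n \<and> True. (cmod (amplitude n U (\<lambda>i. xs ! i)))\<^sup>2)"
    unfolding sum_boson_weight[OF order_refl]
    by (intro sum.cong) (auto simp: sample_space_def sum_list_occupation, auto simp: occupation_def)
  also have "\<dots> = fact n"
    unfolding sum_lists_length_eq amplitude_map
    using sum_amplitude_norm_square[OF assms] by simp
  finally show ?thesis by simp
qed

lemma sum_row_mass:
  assumes "U \<in> unitary_group m" "n \<le> m"
  shows "(\<Sum>i<m. row_mass n U i) = real n"
proof -
  have "(\<Sum>i<m. row_mass n U i) = (\<Sum>j<n. \<Sum>i<m. (cmod (U $$ (i, j)))\<^sup>2)"
    unfolding row_mass_def by (rule sum.swap)
  also have "\<dots> = (\<Sum>j<n. 1)"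
    using assms by (intro sum.cong unitary_group_column_norm) auto
  finally show ?thesis by simp
qed

lemma row_mass_nonneg: "0 \<le> row_mass n U i"
  by (simp add: row_mass_def sum_nonneg)

text \<open>The sum of squared row masses is at most their maximum times their total,
  \<open>1 / (4 * n) * n\<close>, and an outcome with a collision comes only from sequences with a
  repeated mode.\<close>

lemma collision_weight_le:
  assumes U: "U \<in> spread_unitaries m n" and n: "n \<le> m" "1 \<le> n"
  shows "(\<Sum>S\<in>sample_space m n - collision_free m n. boson_weight n U S) \<le> 1 / 2"
proof -
  have U': "U \<in> unitary_group m" using U by (simp add: spread_unitaries_def)
  let ?a = "\<lambda>xs. (cmod (amplitude n U (\<lambda>i. xs ! i)))\<^sup>2"
  have "(\<Sum>j<m. (row_mass n U j)\<^sup>2) \<le> (\<Sum>j<m. 1 / (4 * real n) * row_mass n U j)"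
    unfolding power2_eq_square
    using U by (intro sum_mono mult_right_mono) (auto simp: spread_unitaries_def row_mass_nonneg)
  also have "\<dots> = 1 / (4 * real n) * real n"
    by (simp only: sum_row_mass[OF U' n(1)] flip: sum_distrib_left)
  finally have squares: "(\<Sum>j<m. (row_mass n U j)\<^sup>2) \<le> 1 / 4"
    using n(2) by simp
  have finX: "finite {xs. set xs \<subseteq> {..<m} \<and> length xs = n \<and> \<not> distinct xs}"
    by (rule finite_subset[of _ "{xs. set xs \<subseteq> {..<m} \<and> length xs = n}"])
      (auto intro: finite_lists_length_eq)
  have occ: "\<not> distinct xs" if "set xs \<subseteq> {..<m}" "length xs = n"
    "occupation m xs \<in> sample_space m n - collision_free m n" for xs
  proof
    assume "distinct xs"
    hence "set (occupation m xs) \<subseteq> {0, 1}"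
      by (auto simp: occupation_def distinct_count_atmost_1)
    with that show False by (simp add: collision_free_def)
  qed
  have "fact n * (\<Sum>S\<in>sample_space m n - collision_free m n. boson_weight n U S)
      = (\<Sum>xs | set xs \<subseteq> {..<m} \<and> length xs = n \<and> occupation m xs \<in> sample_space m n - collision_free m n. ?a xs)"
    by (rule sum_boson_weight) auto
  also have "\<dots> \<le> (\<Sum>xs | set xs \<subseteq> {..<m} \<and> length xs = n \<and> \<not> distinct xs. ?a xs)"
    using finX occ by (intro sum_mono2) auto
  also have "\<dots> = (\<Sum>f | f \<in> PiE {..<n} (\<lambda>_. {..<m}) \<and> \<not> inj_on f {..<n}. (cmod (amplitude n U f))\<^sup>2)"
    unfolding sum_lists_length_eq amplitude_map by (simp add: distinct_map atLeast0LessThan)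
  also have "\<dots> \<le> fact n * (2 * (\<Sum>j<m. (row_mass n U j)\<^sup>2))"
    by (rule sum_amplitude_not_inj_le[OF U' n(1)])
  also have "\<dots> \<le> fact n * (2 * (1 / 4))"
    using squares by (intro mult_left_mono) auto
  finally show ?thesis by simp
qed

text \<open>By Cauchy-Schwarz the squared sum of moduli of a row is at most \<open>n\<close> times
  its mass, hence at most \<open>1 / 4\<close>. So each of the \<open>n\<close> factors bounding the
  permanent is at most \<open>1 / 2\<close>.\<close>

lemma boson_weight_collision_free_le:
  assumes U: "U \<in> spread_unitaries m n" and n: "1 \<le> n" and S: "S \<in> collision_free m n"
  shows "boson_weight n U S \<le> (1 / 4) ^ n"
proof -
  have len: "length S = m" "length (row_indices S) = n" and sub: "set S \<subseteq> {0, 1}"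
    using S by (auto simp: collision_free_def sample_space_def length_row_indices)
  have f1: "fact (S ! j) = (1::real)" if "j < m" for j
  proof -
    have "S ! j \<in> {0, 1}" using that len sub nth_mem by blast
    thus ?thesis by auto
  qed
  have "cmod (amplitude n U (\<lambda>i. row_indices S ! i)) \<le> (\<Prod>i<n. \<Sum>j<n. cmod (U $$ (row_indices S ! i, j)))"
    by (rule amplitude_norm_le)
  also have "\<dots> \<le> (\<Prod>i<n. 1 / 2)"
  proof (intro prod_mono conjI sum_nonneg norm_ge_zero)
    fix i assume "i \<in> {..<n}"
    hence "row_indices S ! i \<in> set (row_indices S)"
      using len by (intro nth_mem) simp
    hence i: "row_indices S ! i < m"
      using set_row_indices[of S] len(1) by blast
    have "(\<Sum>j<n. cmod (U $$ (row_indices S ! i, j)))\<^sup>2 \<le> row_mass n U (row_indices S ! i) * real n"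
      unfolding row_mass_def using sum_squared_le_sum_of_squares[of _ "{..<n}"] by simp
    also have "\<dots> \<le> 1 / (4 * real n) * real n"
      using U i by (intro mult_right_mono) (auto simp: spread_unitaries_def)
    also have "\<dots> = (1 / 2)\<^sup>2"
      using n by (simp add: power2_eq_square)
    finally show "(\<Sum>j<n. cmod (U $$ (row_indices S ! i, j))) \<le> 1 / 2"
      by (rule power2_le_imp_le) simp
  qed
  finally have "cmod (amplitude n U (\<lambda>i. row_indices S ! i)) \<le> (1 / 2) ^ n"
    by simp
  hence "(cmod (amplitude n U (\<lambda>i. row_indices S ! i)))\<^sup>2 \<le> ((1 / 2) ^ n)\<^sup>2"
    by (intro power_mono) auto
  also have "\<dots> = (1 / 4) ^ n"
    by (simp add: power2_eq_square flip: power_mult_distrib)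
  finally show ?thesis
    using f1 by (simp add: boson_weight_def permanent_boson_submatrix len)
qed

text \<open>Probabilities can be read off \<open>embed_pmf\<close> once the weights are known to be
  nonnegative with sum one.\<close>

lemma pmf_boson_sampling:
  assumes "U \<in> unitary_group m" "n \<le> m"
  shows "pmf (boson_sampling m n U) S = (if S \<in> sample_space m n then boson_weight n U S else 0)"
proof -
  let ?f = "\<lambda>S. if S \<in> sample_space m n then boson_weight n U S else 0"
  have f_eq: "boson_sampling m n U = embed_pmf ?f"
    unfolding boson_sampling_def by (rule arg_cong[of _ _ embed_pmf])
      (auto simp: fun_eq_iff boson_weight_def sample_space_def)
  have nonneg: "0 \<le> ?f S" for S
    by (simp add: boson_weight_def prod_nonneg)
  have "(\<integral>\<^sup>+ S. ennreal (?f S) \<partial>count_space UNIV) = (\<Sum>S\<in>sample_space m n. ennreal (?f S))"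
    by (rule nn_integral_count_space'[OF finite_sample_space]) auto
  also have "\<dots> = ennreal (\<Sum>S\<in>sample_space m n. ?f S)"
    using nonneg by (rule sum_ennreal)
  also have "\<dots> = 1"
    using sum_boson_weight_sample_space[OF assms] by simp
  finally show ?thesis
    unfolding f_eq using nonneg by (intro pmf_embed_pmf)
qed

text \<open>Collision-free mass at least \<open>1 / 2\<close> both makes the conditioning meaningful
  and limits its cost to a factor 2. Base 4 is weakened to base \<open>exp 1\<close>, which suffices
  for the rate \<open>exp (n / 2)\<close>.\<close>

lemma postselected_boson_sampling_spread:
  assumes U: "U \<in> spread_unitaries m n" and n: "n \<le> m" "1 \<le> n"
  shows "set_pmf (postselected_boson_sampling m n U) \<subseteq> collision_free m n"
    and "pmf (postselected_boson_sampling m n U) S \<le> 2 * exp (- real n)"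
proof -
  let ?D = "boson_sampling m n U" and ?C = "collision_free m n"
  have U': "U \<in> unitary_group m" using U by (simp add: spread_unitaries_def)
  have sub: "?C \<subseteq> sample_space m n" by (auto simp: collision_free_def)
  have "(\<Sum>S\<in>sample_space m n. boson_weight n U S)
      = (\<Sum>S\<in>sample_space m n - ?C. boson_weight n U S) + (\<Sum>S\<in>?C. boson_weight n U S)"
    by (rule sum.subset_diff[OF sub finite_sample_space])
  hence "(\<Sum>S\<in>?C. boson_weight n U S) \<ge> 1 / 2"
    using sum_boson_weight_sample_space[OF U' n(1)] collision_weight_le[OF U n] by linarith
  moreover have "measure_pmf.prob ?D ?C = (\<Sum>S\<in>?C. boson_weight n U S)"
    using sub finite_subset[OF sub finite_sample_space]
    by (auto simp: measure_measure_pmf_finite pmf_boson_sampling[OF U' n(1)] intro!: sum.cong)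
  ultimately have half: "measure_pmf.prob ?D ?C \<ge> 1 / 2" by simp
  have nonempty: "set_pmf ?D \<inter> ?C \<noteq> {}"
    using half measure_Int_set_pmf[of ?D ?C] by (auto simp: Int_commute)
  show "set_pmf (postselected_boson_sampling m n U) \<subseteq> ?C"
    unfolding postselected_boson_sampling_def using set_cond_pmf[OF nonempty] by simp
  show "pmf (postselected_boson_sampling m n U) S \<le> 2 * exp (- real n)"
  proof (cases "S \<in> ?C")
    case True
    have quarter: "1 / 4 \<le> exp (- 1 :: real)"
    proof -
      have "exp 1 \<le> (4 :: real)" using exp_le by linarith
      thus ?thesis by (simp add: exp_minus field_simps)
    qed
    have "pmf (postselected_boson_sampling m n U) S = boson_weight n U S / measure_pmf.prob ?D ?C"
      unfolding postselected_boson_sampling_def pmf_cond[OF nonempty]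
      using True sub by (auto simp: pmf_boson_sampling[OF U' n(1)])
    also have "\<dots> \<le> (1 / 4) ^ n / (1 / 2)"
      using half boson_weight_collision_free_le[OF U n(2) True] by (intro frac_le) auto
    also have "\<dots> \<le> exp (- 1) ^ n / (1 / 2)"
      using quarter by (intro divide_right_mono power_mono) auto
    also have "\<dots> = 2 * exp (- real n)"
      by (simp flip: exp_of_nat_mult)
    finally show ?thesis .
  next
    case False
    thus ?thesis
      unfolding postselected_boson_sampling_def pmf_cond[OF nonempty] by simp
  qed
qed

section \<open>The sample bound and the decay of the failure probability\<close>

text \<open>Small probabilities force a large sample space, so the uniform distribution inherits the
  bound without any estimate of a binomial coefficient.\<close>

lemma card_ge_of_pmf_le:
  assumes "set_pmf p \<subseteq> A" "finite A" "\<And>x. pmf p x \<le> M"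
  shows "1 \<le> real (card A) * M"
proof -
  have "1 = (\<Sum>x\<in>A. pmf p x)"
    using assms by (simp add: sum_pmf_eq_1)
  also have "\<dots> \<le> real (card A) * M"
    using assms(3) by (intro sum_bounded_above)
  finally show ?thesis .
qed

text \<open>With \<open>M = 2 * exp (- n)\<close> and \<open>l \<le> exp (n / 2) / 4\<close>, the
  quantity \<open>M * l\<^sup>2\<close> is at most \<open>1 / 8\<close>, below the required
  \<open>1 / 3\<close>.\<close>

lemma spread_unitary_not_distinguishes:
  assumes U: "U \<in> spread_unitaries m n" and n: "n \<le> m" "1 \<le> n"
    and l: "real l \<le> 1 / 4 * exp (real n / 2)"
    and sym: "symmetric_algorithm (collision_free m n) l A"
  shows "\<not> distinguishes l A (postselected_boson_sampling m n U) (pmf_of_set (collision_free m n))"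
proof -
  let ?C = "collision_free m n" and ?P = "postselected_boson_sampling m n U"
  have fin: "finite ?C"
    by (rule finite_subset[OF _ finite_sample_space[of m n]]) (auto simp: collision_free_def)
  note P = postselected_boson_sampling_spread[OF U n]
  have ne: "?C \<noteq> {}" using P(1) set_pmf_not_empty[of ?P] by auto
  have card: "1 \<le> real (card ?C) * (2 * exp (- real n))"
    by (rule card_ge_of_pmf_le[OF P(1) fin P(2)])
  have card0: "real (card ?C) > 0" using ne fin by (simp add: card_gt_0_iff)
  have Q: "pmf (pmf_of_set ?C) S \<le> 2 * exp (- real n)" for S
    using card card0 ne fin by (simp add: pmf_of_set indicator_def field_simps)
  have "real l ^ 2 \<le> (1 / 4 * exp (real n / 2)) ^ 2"
    using l by (intro power_mono) auto
  also have "\<dots> = exp (real n) / 16"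
    by (simp add: power_mult_distrib power2_eq_square flip: exp_add)
  finally have "2 * exp (- real n) * real l ^ 2 \<le> 2 * exp (- real n) * (exp (real n) / 16)"
    by (intro mult_left_mono) auto
  also have "\<dots> < 1 / 3"
    by (simp flip: exp_add)
  finally show ?thesis
    by (intro symmetric_algorithm_not_distinguishes[OF fin sym P _ Q]) (use ne fin in auto)
qed

lemma spread_failure_tendsto_0:
  fixes \<nu> C :: real and m :: "nat \<Rightarrow> nat"
  assumes nu: "\<nu> > 2" and m_omega: "(\<lambda>n. real (m n)) \<in> \<Omega>(\<lambda>n. real n powr \<nu>)"
  shows "(\<lambda>n. 2 * real (m n) * exp (3 * real n - real (m n) / (32 * real n)) * exp (C * real n)) \<longlonglongrightarrow> 0"
proof -
  obtain c where c: "c > 0" and ev: "\<forall>\<^sub>F n in sequentially. c * norm (real n powr \<nu>) \<le> norm (real (m n))"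
    using landau_omega.bigE[OF m_omega] by blast
  have "filterlim (\<lambda>n. c / 64 * real n powr (\<nu> - 2)) at_top sequentially"
    using nu c by real_asymp
  \<comment> \<open>The 4 is made of 3 for the factor \<open>exp (3 * n)\<close> and 1 for a
    remaining decay \<open>exp (- n)\<close>; \<open>C\<close> pays for
    \<open>exp (C * n)\<close>.\<close>
  hence ev2: "\<forall>\<^sub>F n in sequentially. 4 + C \<le> c / 64 * real n powr (\<nu> - 2)"
    unfolding filterlim_at_top by blast
  show ?thesis
  proof (rule tendsto_sandwich[of "\<lambda>_. 0"])
    show "\<forall>\<^sub>F n in sequentially. 2 * real (m n) * exp (3 * real n - real (m n) / (32 * real n)) * exp (C * real n)
        \<le> 128 * real n * exp (- real n)"
      using ev ev2 eventually_gt_at_top[of 0]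
    proof eventually_elim
      case (elim n)
      \<comment> \<open>\<open>x\<close> is half of the tail exponent \<open>m / (32 * n)\<close>.
        One half absorbs the prefactor \<open>m = 64 * n * x\<close> through
        \<open>x \<le> exp x\<close>; the other half must beat \<open>(3 + C) * n\<close>.\<close>
      define x where "x = real (m n) / (64 * real n)"
      have n: "real n > 0" using elim by simp
      have m: "real (m n) = 64 * real n * x" using n by (simp add: x_def)
      have "x \<le> exp x" using exp_ge_add_one_self[of x] by linarith
      have "c * real n powr \<nu> / (64 * real n) \<le> x"
        unfolding x_def using elim n by (intro divide_right_mono) auto
      moreover have "real n powr \<nu> = real n powr (\<nu> - 2) * real n * real n"
      proof -
        have "real n powr \<nu> = real n powr (\<nu> - 2) * real n powr 2"
          unfolding powr_add[symmetric] by simp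
        moreover have "real n powr 2 = real n * real n"
          using n by (simp add: powr_numeral power2_eq_square)
        ultimately show ?thesis by simp
      qed
      ultimately have "c / 64 * real n powr (\<nu> - 2) * real n \<le> x"
        using n by (simp add: field_simps)
      moreover have "(4 + C) * real n \<le> c / 64 * real n powr (\<nu> - 2) * real n"
        using elim n by (intro mult_right_mono) auto
      ultimately have x: "(4 + C) * real n \<le> x" by linarith
      have "2 * real (m n) * exp (3 * real n - real (m n) / (32 * real n)) * exp (C * real n)
          = 128 * real n * (x * exp (3 * real n - 2 * x + C * real n))"
        using n by (simp add: m mult_ac flip: exp_add)
      also have "\<dots> \<le> 128 * real n * (exp x * exp (3 * real n - 2 * x + C * real n))"
        using \<open>x \<le> exp x\<close> n by (intro mult_left_mono mult_right_mono) auto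
      also have "\<dots> = 128 * real n * exp ((3 + C) * real n - x)"
        by (simp add: algebra_simps flip: exp_add)
      also have "\<dots> \<le> 128 * real n * exp (- real n)"
        using x n by (intro mult_left_mono) (auto simp: algebra_simps)
      finally show ?case .
    qed
    show "(\<lambda>n. 128 * real n * exp (- real n)) \<longlonglongrightarrow> 0"
      by real_asymp
  qed auto
qed

theorem theorem1:
  fixes \<nu> :: real and m :: "nat \<Rightarrow> nat"
  assumes nu: "\<nu> > 2"
    and m_ge: "\<And>n. n \<ge> 1 \<Longrightarrow> m n \<ge> n"
    and m_poly: "\<exists>k::nat. (\<lambda>n. real (m n)) \<in> O(\<lambda>n. real n ^ k)"
    and m_omega: "(\<lambda>n. real (m n)) \<in> \<Omega>(\<lambda>n. real n powr \<nu>)"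
  shows "\<exists>a::real. a > 0 \<and> (\<exists>\<delta> :: nat \<Rightarrow> real.
    (\<forall>n\<ge>1. 0 \<le> \<delta> n \<and> \<delta> n \<le> 1) \<and>
    (\<forall>C::real. C > 0 \<longrightarrow> (\<lambda>n. \<delta> n * exp (C * real n)) \<longlonglongrightarrow> 0) \<and>
    (\<forall>n\<ge>1. \<forall>\<mu>. is_haar_measure (m n) \<mu> \<longrightarrow>
      (\<exists>E \<in> sets \<mu>. measure \<mu> E \<ge> 1 - \<delta> n \<and>
        (\<forall>U \<in> E. \<forall>l::nat. l \<ge> 1 \<and> real l \<le> a * exp (real n / 2) \<longrightarrow>
          \<not> (\<exists>A. symmetric_algorithm (collision_free (m n) n) l A \<and>
            distinguishes l A (postselected_boson_sampling (m n) n U)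
              (pmf_of_set (collision_free (m n) n)))))))"
proof (intro exI[of _ "1 / 4 :: real"] exI[of _ "\<lambda>n. min 1 (2 * real (m n) * exp (3 * real n - real (m n) / (32 * real n)))"]
    conjI allI impI)
  let ?f = "\<lambda>n. 2 * real (m n) * exp (3 * real n - real (m n) / (32 * real n))"
  fix C :: real
  have "(\<lambda>n. ?f n * exp (C * real n)) \<longlonglongrightarrow> 0"
    by (rule spread_failure_tendsto_0[OF nu m_omega])
  moreover have "\<forall>\<^sub>F n in sequentially. min 1 (?f n) * exp (C * real n) \<le> ?f n * exp (C * real n)"
    by (intro always_eventually allI mult_right_mono) auto
  ultimately show "(\<lambda>n. min 1 (?f n) * exp (C * real n)) \<longlonglongrightarrow> 0"
    by (intro tendsto_sandwich[of "\<lambda>_. 0" "\<lambda>n. min 1 (?f n) * exp (C * real n)"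
        sequentially "\<lambda>n. ?f n * exp (C * real n)"]) auto
next
  fix n :: nat and \<mu> assume n: "1 \<le> n" and haar: "is_haar_measure (m n) \<mu>"
  let ?d = "2 * real (m n) * exp (3 * real n - real (m n) / (32 * real n))"
  have nm: "n \<le> m n" using m_ge[OF n] .
  show "\<exists>E\<in>sets \<mu>. 1 - min 1 ?d \<le> measure \<mu> E \<and>
      (\<forall>U\<in>E. \<forall>l. 1 \<le> l \<and> real l \<le> 1 / 4 * exp (real n / 2) \<longrightarrow>
        \<not> (\<exists>A. symmetric_algorithm (collision_free (m n) n) l A \<and>
          distinguishes l A (postselected_boson_sampling (m n) n U)
            (pmf_of_set (collision_free (m n) n))))"
  proof (intro bexI[OF _ haar_spread_unitaries(1)[OF haar nm]] conjI ballI allI impI notI)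
    \<comment> \<open>For small \<open>n\<close> the bound \<open>?d\<close> may exceed 1; there
      \<open>min\<close> caps it and the claim is nonnegativity of the measure.\<close>
    show "1 - min 1 ?d \<le> measure \<mu> (spread_unitaries (m n) n)"
      using haar_spread_unitaries(2)[OF haar nm] measure_nonneg[of \<mu> "spread_unitaries (m n) n"]
      by (auto simp: min_def)
  next
    fix U l
    assume "U \<in> spread_unitaries (m n) n" "1 \<le> l \<and> real l \<le> 1 / 4 * exp (real n / 2)"
      "\<exists>A. symmetric_algorithm (collision_free (m n) n) l A \<and>
        distinguishes l A (postselected_boson_sampling (m n) n U)
          (pmf_of_set (collision_free (m n) n))"
    thus False
      using spread_unitary_not_distinguishes[OF _ nm n] by blast
  qed
qed auto

end
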